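(* Let $k>4$, $p>1$, and let $f\in L^p(\mathbb{R})$ be a probability density on $\mathbb{R}$ with $\int_{\mathbb{R}}|x|^kf(x)\,dx<\infty$. Assume that $\int_{\mathbb{R}}x^2f(x)\,dx=1$ and $I(f\mid\gamma)<\infty$. Then $(\hat f^N)_N$ is entropically chaotic to $f$, with the following explicit rate: for any $\eta<\frac18\frac{k-2}{k+1}$, there exists a constant $C>0$ (independent of $N$) such that for all $N$ $$\left|\frac1NH(\hat f^N\mid\sigma^N)-H(f\mid\gamma)\right|\le C\big(N^{-\eta}+N^{-(k/4-1)}\big).$$
   Context: $\gamma(x)=\frac1{\sqrt{2\pi}}e^{-x^2/2}$. Relative entropy: $H(\mu\mid\nu)=\int h\log h\,d\nu$ with $h=d\mu/d\nu$, and $+\infty$ if $\mu\not\ll\nu$. Relative Fisher information on $\mathbb{R}$: $I(f\mid\gamma)=\int_{\mathbb{R}}\frac{|h'(x)|^2}{h(x)}\gamma(x)\,dx$ with $h=f/\gamma$, and $+\infty$ when $h$ does not have a continuous first derivative. Kac's sphere is $S^{N-1}=\{x\in\mathbb{R}^N:\sum_i x_i^2=N\}$, with uniform probability measure $\sigma^N$. For $x\in\mathbb{R}^N\setminus\{0\}$ put $\hat x=\frac{\sqrt N}{|x|}x\in S^{N-1}$. $\hat f^N$ is the push-forward of $f^{\otimes N}$ under $x\mapsto\hat x$ (a probability measure on $S^{N-1}$). Kac chaos: a sequence $(F^N)_N$ of permutation-invariant probability measures on $\mathbb{R}^N$ is Kac chaotic to $f$ if for every $k\in\mathbb{N}$ the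 marginal of $F^N$ on its first $k$ coordinates converges weakly to $f^{\otimes k}$ as $N\to\infty$. Entropic chaos: a sequence $(F^N)_N$ of permutation-invariant probability measures on $S^{N-1}$ is entropically chaotic to $f$ (with $H(f\mid\gamma)<\infty$) if it is Kac chaotic to $f$ and $\lim_{N\to\infty}\frac1NH(F^N\mid\sigma^N)=H(f\mid\gamma)$. *)

theory Defs
  imports "HOL-Probability.Probability"
begin

text \<open>
  Extended-valued, with natural logarithm. When \<open>\<nu>\<close> is a finite measure, the negative part of
  \<open>h * ln h\<close> is bounded, hence integrable; so if \<open>h * ln h\<close> is not integrable, then its integral
  is \<open>+\<infinity>\<close>. This is why both exceptional cases are assigned the value \<open>\<infinity>\<close>.
  (\<open>KL_divergence\<close> from the library is real-valued and equals \<open>0\<close> in the non-integrable case.)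
\<close>

definition relative_entropy :: "'a measure \<Rightarrow> 'a measure \<Rightarrow> ereal" where
  "relative_entropy \<mu> \<nu> =
     (let h = (\<lambda>x. enn2real (RN_deriv \<nu> \<mu> x)) in
      if absolutely_continuous \<nu> \<mu> \<and> integrable \<nu> (\<lambda>x. h x * ln (h x))
      then ereal (\<integral>x. h x * ln (h x) \<partial>\<nu>) else \<infinity>)"

text \<open>
  Where \<open>h\<close> vanishes the quotient \<open>(deriv h x)\<^sup>2 / h x\<close> is \<open>0\<close>, which is the usual convention: for a
  nonnegative differentiable \<open>h\<close> the derivative vanishes there as well.
\<close>

definition fisher_information_std_normal :: "(real \<Rightarrow> real) \<Rightarrow> ennreal" where
  "fisher_information_std_normal f =
     (let h = (\<lambda>x. f x / std_normal_density x) in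
      if h C1_differentiable_on UNIV
      then (\<integral>\<^sup>+x. ennreal (\<bar>deriv h x\<bar>\<^sup>2 / h x * std_normal_density x) \<partial>lborel) else \<infinity>)"

text \<open>
  \<open>\<real>\<^sup>N\<close> is the set of extensional functions on \<open>{..<N}\<close>, with the product \<open>\<sigma>\<close>-algebra. Measures on
  the sphere are represented as measures on \<open>\<real>\<^sup>N\<close> that are concentrated on the sphere.
\<close>

abbreviation borel_pow :: "nat \<Rightarrow> (nat \<Rightarrow> real) measure" where
  "borel_pow N \<equiv> (\<Pi>\<^sub>M i\<in>{..<N}. borel)"

definition measure_pow :: "real measure \<Rightarrow> nat \<Rightarrow> (nat \<Rightarrow> real) measure" where
  "measure_pow \<mu> N = (\<Pi>\<^sub>M i\<in>{..<N}. \<mu>)"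

definition norm_pow :: "nat \<Rightarrow> (nat \<Rightarrow> real) \<Rightarrow> real" where
  "norm_pow N x = sqrt (\<Sum>i<N. (x i)\<^sup>2)"

definition kac_sphere :: "nat \<Rightarrow> (nat \<Rightarrow> real) set" where
  "kac_sphere N = {x \<in> (\<Pi>\<^sub>E i\<in>{..<N}. UNIV). (\<Sum>i<N. (x i)\<^sup>2) = real N}"

definition sphere_proj :: "nat \<Rightarrow> (nat \<Rightarrow> real) \<Rightarrow> (nat \<Rightarrow> real)" where
  "sphere_proj N x = (\<lambda>i\<in>{..<N}. sqrt (real N) / norm_pow N x * x i)"

text \<open>
  \<open>sphere_proj\<close> sends the origin to itself, off the sphere. For \<open>N \<ge> 1\<close> the origin is a null set
  of Lebesgue measure, and of the powers of a measure that has a Lebesgue density.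

  The uniform probability measure is the normalised surface measure in its usual construction via
  cones: the measure of \<open>A\<close> is the Lebesgue measure of the cone \<open>{t x | x \<in> A, 0 < t \<le> 1}\<close>, divided by
  the Lebesgue measure of the ball of radius \<open>sqrt N\<close>.
\<close>

definition sphere_uniform :: "nat \<Rightarrow> (nat \<Rightarrow> real) measure" where
  "sphere_uniform N =
     distr (uniform_measure (measure_pow lborel N)
              {x \<in> space (measure_pow lborel N). norm_pow N x \<le> sqrt (real N)})
           (borel_pow N) (sphere_proj N)"

definition projected_pow :: "real measure \<Rightarrow> nat \<Rightarrow> (nat \<Rightarrow> real) measure" where
  "projected_pow \<mu> N = distr (measure_pow \<mu> N) (borel_pow N) (sphere_proj N)"

definition permutation_invariant :: "nat \<Rightarrow> (nat \<Rightarrow> real) measure \<Rightarrow> bool" where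
  "permutation_invariant N F \<longleftrightarrow>
     (\<forall>\<pi>. \<pi> permutes {..<N} \<longrightarrow> distr F (borel_pow N) (\<lambda>x. \<lambda>i\<in>{..<N}. x (\<pi> i)) = F)"

definition marginal :: "nat \<Rightarrow> (nat \<Rightarrow> real) measure \<Rightarrow> (nat \<Rightarrow> real) measure" where
  "marginal k F = distr F (borel_pow k) (\<lambda>x. restrict x {..<k})"

definition weakly_converges ::
  "'a topology \<Rightarrow> (nat \<Rightarrow> 'a measure) \<Rightarrow> 'a measure \<Rightarrow> bool" where
  "weakly_converges X M M' \<longleftrightarrow>
     (\<forall>\<phi>. continuous_map X euclideanreal \<phi> \<and> bounded (\<phi> ` topspace X) \<longrightarrow>
        (\<lambda>n. \<integral>x. \<phi> x \<partial>M n) \<longlonglongrightarrow> (\<integral>x. \<phi> x \<partial>M'))"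

text \<open>Sequences are indexed by \<open>N \<ge> 1\<close>, and the marginal is meaningful only for \<open>N \<ge> k\<close>; neither
  restriction affects the limits.\<close>

definition kac_chaotic :: "(nat \<Rightarrow> (nat \<Rightarrow> real) measure) \<Rightarrow> real measure \<Rightarrow> bool" where
  "kac_chaotic F \<mu> \<longleftrightarrow>
     (\<forall>N\<ge>1. prob_space (F N) \<and> sets (F N) = sets (borel_pow N) \<and> permutation_invariant N (F N)) \<and>
     (\<forall>k. weakly_converges (powertop_real {..<k}) (\<lambda>N. marginal k (F N)) (measure_pow \<mu> k))"

definition entropically_chaotic ::
  "(nat \<Rightarrow> (nat \<Rightarrow> real) measure) \<Rightarrow> real measure \<Rightarrow> bool" where
  "entropically_chaotic F \<mu> \<longleftrightarrow>
     (\<forall>N\<ge>1. AE x in F N. x \<in> kac_sphere N) \<and>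
     relative_entropy \<mu> (density lborel std_normal_density) < \<infinity> \<and>
     kac_chaotic F \<mu> \<and>
     (\<lambda>N. ereal (1 / real N) * relative_entropy (F N) (sphere_uniform N))
       \<longlonglongrightarrow> relative_entropy \<mu> (density lborel std_normal_density)"

end

theory Submission
  imports Defs "HOL-Real_Asymp.Real_Asymp"
begin

text \<open>
  The projection maps the \<open>N\<close>-th power of the normal distribution to the uniform distribution of the
  sphere, so data processing gives \<open>H(\<mu>\<^sup>N projected | \<sigma>\<^sup>N) \<le> N H(f | \<gamma>)\<close>.

  For the converse, finite Fisher information makes \<open>f\<close> bounded and Hoelder continuous of exponent
  \<open>1/2\<close>. Put \<open>\<phi> = (1 - \<epsilon>) f + \<epsilon> g\<close> with \<open>g\<close> a fixed density of tail \<open>\<bar>x\<bar> powr (-3/2)\<close>. The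
  lower bound \<open>\<phi> \<ge> \<epsilon> g\<close> controls \<open>ln \<phi>\<close>: replacing a point by its projection changes
  \<open>\<Sum>i<N. ln (\<phi> (x i))\<close> by at most a constant times \<open>N powr (3/4) / \<epsilon>\<close> on average. Hence the function
  \<open>\<Sum>i<N. ln (\<phi> (y i) / \<gamma> (y i))\<close> on the sphere can be inserted into the variational formula for the
  relative entropy; its exponential integral is bounded by that of a shell in \<open>\<real>\<^sup>N\<close>, where \<open>\<phi>\<close> is a
  probability density. The choice \<open>\<epsilon> = N powr (-1/8) / 2\<close> balances the errors and gives the rate
  \<open>N powr (-1/8)\<close>.
\<close>

section \<open>Cone measure and polar coordinates\<close>

text \<open>The obstacle to the lower bound is that \<open>f\<close> may vanish or decay fast, so
  that ln f is unstable even under the small radial move from a point to its projection. Mixing buys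
  a polynomial lower bound at the price of a factor 1 - \<epsilon> per coordinate. The exponents fit
  together as follows. A Hoelder increment of order 1/2, divided by a lower bound of size \<epsilon>
  |x|^(-3/2), grows like x^2, and the squares sum to N on the sphere. By the finite fourth moment
  the relative deviation of the squared radius has size N^(-1/2); its square root costs N^(-1/4) per
  coordinate. After division by N the losses are N^(-1/4) / \<epsilon> from moving the points and a
  multiple of \<epsilon> from mixing, which agree in order for \<epsilon> of order N^(-1/8). The
  density of the projected measure enters only through its existence: both bounds on its entropy
  come from one convexity inequality, in which this density takes opposite roles.\<close>

lemma sets_measure_pow [measurable_cong]:
  "sets \<mu> = sets borel \<Longrightarrow> sets (measure_pow \<mu> N) = sets (borel_pow N)"
  unfolding measure_pow_def by (rule sets_PiM_cong) auto

lemma sets_measure_pow_lborel [measurable_cong]: "sets (measure_pow lborel N) = sets (borel_pow N)"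
  by (rule sets_measure_pow) simp

lemma sets_measure_pow_density [measurable_cong]:
  "sets (measure_pow (density lborel f) N) = sets (borel_pow N)"
  by (rule sets_measure_pow) simp

lemma space_measure_pow:
  "sets \<mu> = sets borel \<Longrightarrow> space (measure_pow \<mu> N) = (\<Pi>\<^sub>E i\<in>{..<N}. UNIV)"
  using sets_eq_imp_space_eq[OF sets_measure_pow, of \<mu> N] by (simp add: space_PiM)

lemma measurable_norm_pow [measurable]: "norm_pow N \<in> borel_measurable (borel_pow N)"
  unfolding norm_pow_def by measurable

lemma measurable_sphere_proj [measurable]: "sphere_proj N \<in> borel_pow N \<rightarrow>\<^sub>M borel_pow N"
  unfolding sphere_proj_def by measurable

lemma norm_pow_nonneg: "0 \<le> norm_pow N x"
  by (simp add: norm_pow_def sum_nonneg)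

lemma norm_pow_sq: "(norm_pow N x)\<^sup>2 = (\<Sum>i<N. (x i)\<^sup>2)"
  by (simp add: norm_pow_def sum_nonneg)

lemma sphere_proj_sum_sq:
  assumes "norm_pow N x \<noteq> 0"
  shows "(\<Sum>i<N. (sphere_proj N x i)\<^sup>2) = real N"
proof -
  have "(\<Sum>i<N. (sphere_proj N x i)\<^sup>2) = (\<Sum>i<N. real N / (norm_pow N x)\<^sup>2 * (x i)\<^sup>2)"
    by (intro sum.cong) (auto simp: sphere_proj_def power_mult_distrib power_divide)
  also have "\<dots> = real N / (norm_pow N x)\<^sup>2 * (norm_pow N x)\<^sup>2"
    by (simp add: norm_pow_sq sum_distrib_left)
  finally show ?thesis using assms by simp
qed

lemma sphere_proj_mem_kac_sphere: "norm_pow N x \<noteq> 0 \<Longrightarrow> sphere_proj N x \<in> kac_sphere N"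
  using sphere_proj_sum_sq[of N x] by (simp add: kac_sphere_def) (simp add: sphere_proj_def)

section \<open>Dilations, balls and the cone measure\<close>

definition dilate :: "nat \<Rightarrow> real \<Rightarrow> (nat \<Rightarrow> real) \<Rightarrow> (nat \<Rightarrow> real)" where
  "dilate N c x = (\<lambda>i\<in>{..<N}. c * x i)"

lemma measurable_dilate [measurable]: "dilate N c \<in> borel_pow N \<rightarrow>\<^sub>M borel_pow N"
  unfolding dilate_def by measurable

lemma norm_pow_dilate: "0 \<le> c \<Longrightarrow> norm_pow N (dilate N c x) = c * norm_pow N x"
  by (simp add: norm_pow_def dilate_def power_mult_distrib sum_distrib_left[symmetric] real_sqrt_mult)

lemma sphere_proj_dilate: "0 < c \<Longrightarrow> sphere_proj N (dilate N c x) = sphere_proj N x"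
  unfolding sphere_proj_def norm_pow_dilate[OF less_imp_le]
  by (auto simp: dilate_def restrict_def)

text \<open>The image of Lebesgue measure under the dilation, weighted by c^N, agrees with Lebesgue
  measure on boxes, where it is the one-dimensional affine change of variables in each coordinate.
  Uniqueness of product measures does the rest.\<close>

lemma emeasure_dilate_vimage:
  assumes "c > 0" and A: "A \<in> sets (borel_pow N)"
  shows "emeasure (measure_pow lborel N) (dilate N c -` A \<inter> space (borel_pow N)) * ennreal (c ^ N)
    = emeasure (measure_pow lborel N) A"
proof -
  interpret product_sigma_finite "\<lambda>_. lborel :: real measure" ..
  let ?P = "density (distr (measure_pow lborel N) (borel_pow N) (dilate N c)) (\<lambda>_. ennreal (c ^ N))"
  have "?P = PiM {..<N} (\<lambda>_. lborel)"
  proof (rule PiM_eqI)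
    show "sets ?P = sets (PiM {..<N} (\<lambda>_. lborel :: real measure))"
      using sets_measure_pow_lborel[of N] by (simp add: measure_pow_def)
    fix B :: "nat \<Rightarrow> real set"
    assume "\<And>i. i \<in> {..<N} \<Longrightarrow> B i \<in> sets lborel"
    then have B: "B i \<in> sets borel" if "i < N" for i using that by auto
    then have PB: "Pi\<^sub>E {..<N} B \<in> sets (borel_pow N)" by (intro sets_PiM_I_finite) auto
    have "emeasure (distr (measure_pow lborel N) (borel_pow N) (dilate N c)) (Pi\<^sub>E {..<N} B)
       = emeasure (measure_pow lborel N) (dilate N c -` Pi\<^sub>E {..<N} B \<inter> space (borel_pow N))"
      using PB by (subst emeasure_distr) (auto simp: space_measure_pow space_PiM)
    also have "dilate N c -` Pi\<^sub>E {..<N} B \<inter> space (borel_pow N) = Pi\<^sub>E {..<N} (\<lambda>i. (\<lambda>t. c * t) -` B i)"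
      by (auto simp: dilate_def space_PiM PiE_iff)
    also have "emeasure (measure_pow lborel N) \<dots> = (\<Prod>i<N. emeasure lborel ((\<lambda>t. c * t) -` B i))"
      unfolding measure_pow_def
    proof (intro emeasure_PiM)
      fix i assume "i \<in> {..<N}"
      have "(\<lambda>t::real. c * t) \<in> borel \<rightarrow>\<^sub>M borel" by measurable
      from measurable_sets[OF this B, of i] \<open>i \<in> {..<N}\<close>
      show "(\<lambda>t. c * t) -` B i \<in> sets lborel" by simp
    qed simp
    finally have 1: "emeasure (distr (measure_pow lborel N) (borel_pow N) (dilate N c)) (Pi\<^sub>E {..<N} B)
      = (\<Prod>i<N. emeasure lborel ((\<lambda>t. c * t) -` B i))" .
    have 2: "ennreal c * emeasure lborel ((\<lambda>t. c * t) -` B i) = emeasure lborel (B i)" if "i < N" for i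
    proof -
      have "emeasure lborel (B i) = emeasure (density (distr lborel borel (\<lambda>t. 0 + c * t)) (\<lambda>_. \<bar>c\<bar>)) (B i)"
        by (subst lborel_real_affine[of c 0]) (use assms in auto)
      also have "\<dots> = ennreal c * emeasure (distr lborel borel (\<lambda>t. 0 + c * t)) (B i)"
        using B[OF that] assms by (subst emeasure_density) (auto simp: nn_integral_cmult_indicator)
      also have "\<dots> = ennreal c * emeasure lborel ((\<lambda>t. c * t) -` B i)"
        using B[OF that] by (subst emeasure_distr) auto
      finally show ?thesis by simp
    qed
    have "emeasure ?P (Pi\<^sub>E {..<N} B) = ennreal (c ^ N) * (\<Prod>i<N. emeasure lborel ((\<lambda>t. c * t) -` B i))"
      using PB by (subst emeasure_density) (auto simp: nn_integral_cmult_indicator 1[symmetric])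
    also have "\<dots> = (\<Prod>i<N. ennreal c * emeasure lborel ((\<lambda>t. c * t) -` B i))"
      using assms by (simp add: prod.distrib ennreal_power)
    also have "\<dots> = (\<Prod>i<N. emeasure lborel (B i))" by (intro prod.cong) (auto simp: 2)
    finally show "emeasure ?P (Pi\<^sub>E {..<N} B) = (\<Prod>i\<in>{..<N}. emeasure lborel (B i))" by simp
  qed simp
  then have "emeasure (measure_pow lborel N) A = emeasure ?P A" by (simp add: measure_pow_def)
  also have "\<dots> = ennreal (c ^ N) * emeasure (measure_pow lborel N) (dilate N c -` A \<inter> space (borel_pow N))"
    using A by (subst emeasure_density) (auto simp: nn_integral_cmult_indicator emeasure_distr space_measure_pow space_PiM)
  finally show ?thesis by (simp add: mult.commute)
qed

definition pball :: "nat \<Rightarrow> real \<Rightarrow> (nat \<Rightarrow> real) set" where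
  "pball N r = {x \<in> space (borel_pow N). norm_pow N x \<le> r}"

lemma pball_sets [measurable]: "pball N r \<in> sets (borel_pow N)"
  unfolding pball_def by measurable

lemma emeasure_pball: "r > 0 \<Longrightarrow> emeasure (measure_pow lborel N) (pball N r) = ennreal (unit_ball_vol N * r ^ N)"
  using emeasure_cball_aux[of "{..<N}" r]
  by (simp add: measure_pow_def pball_def norm_pow_def space_PiM Int_def conj_commute)

lemma emeasure_pball_nontrivial:
  assumes "r > 0"
  shows "emeasure (measure_pow lborel N) (pball N r) \<noteq> 0" "emeasure (measure_pow lborel N) (pball N r) \<noteq> \<infinity>"
proof -
  have "0 < unit_ball_vol (real N) * r ^ N" using assms by (intro mult_pos_pos unit_ball_vol_pos) auto
  then show "emeasure (measure_pow lborel N) (pball N r) \<noteq> 0" 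
    by (simp only: emeasure_pball[OF assms] ennreal_eq_0_iff not_le)
qed (use assms in \<open>simp add: emeasure_pball\<close>)

lemma sphere_uniform_eq:
  "sphere_uniform N = distr (uniform_measure (measure_pow lborel N) (pball N (sqrt N))) (borel_pow N) (sphere_proj N)"
  by (simp add: sphere_uniform_def pball_def space_measure_pow space_PiM)

lemma sets_sphere_uniform [measurable_cong, simp]: "sets (sphere_uniform N) = sets (borel_pow N)"
  by (simp add: sphere_uniform_eq)

lemma prob_space_sphere_uniform:
  assumes "N \<ge> 1" shows "prob_space (sphere_uniform N)"
proof -
  interpret U: prob_space "uniform_measure (measure_pow lborel N) (pball N (sqrt N))"
    using emeasure_pball_nontrivial[of "sqrt N" N] assms by (intro prob_space_uniform_measure) auto
  show ?thesis unfolding sphere_uniform_eq by (rule U.prob_space_distr) measurable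
qed

text \<open>For radius \<open>sqrt N\<close> this is the definition of the cone measure. A dilation
  leaves the direction unchanged, so it maps truncated cones to truncated cones, and both sides
  scale by the same N-th power.\<close>

lemma emeasure_sphere_uniform:
  assumes "N \<ge> 1" "B \<in> sets (borel_pow N)" "r > 0"
  shows "emeasure (measure_pow lborel N) {x \<in> pball N r. sphere_proj N x \<in> B}
    = emeasure (measure_pow lborel N) (pball N r) * emeasure (sphere_uniform N) B"
proof -
  define s where "s = sqrt N"
  have s: "s > 0" using assms by (simp add: s_def)
  let ?L = "measure_pow lborel N"
  note B[measurable] = assms(2)
  have S[measurable]: "{x \<in> pball N r. sphere_proj N x \<in> B} \<in> sets (borel_pow N)" for r
    unfolding pball_def by measurable
  have sc: "emeasure ?L {x \<in> pball N (c * r). sphere_proj N x \<in> B}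
      = ennreal (c ^ N) * emeasure ?L {x \<in> pball N r. sphere_proj N x \<in> B}" if "c > 0" for c r
  proof -
    have "dilate N c -` {x \<in> pball N (c * r). sphere_proj N x \<in> B} \<inter> space (borel_pow N)
       = {x \<in> pball N r. sphere_proj N x \<in> B}"
      using that measurable_space[OF measurable_dilate[of N c]]
      by (auto simp: pball_def norm_pow_dilate sphere_proj_dilate)
    then show ?thesis using emeasure_dilate_vimage[OF that S[of "c*r"]] by (simp add: mult.commute)
  qed
  have SS: "{x \<in> space (borel_pow N). sphere_proj N x \<in> B} \<in> sets (borel_pow N)" by measurable
  have "emeasure (sphere_uniform N) B =
     emeasure ?L (pball N s \<inter> {x \<in> space (borel_pow N). sphere_proj N x \<in> B}) / emeasure ?L (pball N s)"
    unfolding sphere_uniform_eq s_def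
    using SS by (subst emeasure_distr, measurable, subst emeasure_uniform_measure)
      (auto simp: space_measure_pow space_PiM vimage_def Int_def conj_commute sets_measure_pow)
  also have "pball N s \<inter> {x \<in> space (borel_pow N). sphere_proj N x \<in> B} = {x \<in> pball N s. sphere_proj N x \<in> B}"
    by (auto simp: pball_def)
  finally have 1: "emeasure ?L {x \<in> pball N s. sphere_proj N x \<in> B} = emeasure ?L (pball N s) * emeasure (sphere_uniform N) B"
    using emeasure_pball_nontrivial[OF s, of N]
    by (simp add: ennreal_times_divide mult.commute[of _ "emeasure ?L {x \<in> pball N s. sphere_proj N x \<in> B}"] mult_divide_eq_ennreal)
  have "emeasure ?L {x \<in> pball N r. sphere_proj N x \<in> B}
     = ennreal ((r/s) ^ N) * emeasure ?L {x \<in> pball N s. sphere_proj N x \<in> B}"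
    using sc[of "r/s" s] s \<open>r > 0\<close> by simp
  also have "\<dots> = (ennreal ((r/s) ^ N) * emeasure ?L (pball N s)) * emeasure (sphere_uniform N) B"
    by (simp add: 1 mult.assoc)
  also have "ennreal ((r/s) ^ N) * emeasure ?L (pball N s) = emeasure ?L (pball N r)"
    using s \<open>r > 0\<close> by (simp add: emeasure_pball ennreal_mult[symmetric] power_divide)
  finally show ?thesis .
qed

lemma emeasure_distr_pow:
  assumes "sets M = sets (borel_pow N)" "f \<in> borel_pow N \<rightarrow>\<^sub>M M'" "A \<in> sets M'"
  shows "emeasure (distr M M' f) A = emeasure M {x \<in> space (borel_pow N). f x \<in> A}"
proof -
  have "f \<in> M \<rightarrow>\<^sub>M M'" using assms(2) by (simp add: measurable_cong_sets[OF assms(1) refl])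
  moreover have "f -` A \<inter> space M = {x \<in> space (borel_pow N). f x \<in> A}"
    using sets_eq_imp_space_eq[OF assms(1)] by auto
  ultimately show ?thesis using assms(3) by (simp add: emeasure_distr)
qed

text \<open>The degenerate ball \<open>pball N 0\<close> is invariant under the dilation by 2, so
  its finite measure equals 2^N times itself; for N \<ge> 1 it must vanish.\<close>

lemma emeasure_pball_nonpos:
  assumes "N \<ge> 1" "r \<le> 0"
  shows "emeasure (measure_pow lborel N) (pball N r) = 0"
proof -
  let ?e = "emeasure (measure_pow lborel N) (pball N 0)"
  have "dilate N 2 -` pball N 0 \<inter> space (borel_pow N) = pball N 0"
    using measurable_space[OF measurable_dilate[of N 2]] by (auto simp: pball_def norm_pow_dilate)
  then have e: "?e * ennreal (2 ^ N) = ?e" using emeasure_dilate_vimage[of 2 "pball N 0" N] by simp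
  have "?e \<le> emeasure (measure_pow lborel N) (pball N 1)"
    by (intro emeasure_mono) (auto simp: pball_def sets_measure_pow_lborel intro!: pball_sets[unfolded pball_def])
  then have "?e \<noteq> \<infinity>" using emeasure_pball_nontrivial(2)[of 1 N] by (auto simp: top_unique)
  then obtain e' where e': "?e = ennreal e'" "e' \<ge> 0" by (cases ?e) auto
  with e have "e' * 2 ^ N = e'" by (simp add: ennreal_mult[symmetric])
  moreover have "(2::real) ^ N > 1" using assms by (intro one_less_power) auto
  ultimately have "e' = 0" by auto
  have "emeasure (measure_pow lborel N) (pball N r) \<le> ?e"
    using assms by (intro emeasure_mono) (auto simp: pball_def sets_measure_pow_lborel intro!: pball_sets[unfolded pball_def])
  then show ?thesis using e' \<open>e' = 0\<close> by simp
qed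

lemma AE_lborel_norm_pow_nonzero:
  assumes "N \<ge> 1"
  shows "AE x in measure_pow lborel N. norm_pow N x \<noteq> 0"
proof (rule AE_I')
  show "pball N 0 \<in> null_sets (measure_pow lborel N)"
    using emeasure_pball_nonpos[OF assms, of 0] by (auto simp: null_sets_def sets_measure_pow_lborel)
  show "{x \<in> space (measure_pow lborel N). \<not> norm_pow N x \<noteq> 0} \<subseteq> pball N 0"
  proof
    fix x assume "x \<in> {x \<in> space (measure_pow lborel N). \<not> norm_pow N x \<noteq> 0}"
    then show "x \<in> pball N 0" by (simp add: pball_def space_measure_pow space_PiM)
  qed
qed

text \<open>Radius and direction are independent under Lebesgue measure: their joint image is the
  product of the radial measure \<open>R\<close> and the cone measure. The radial measure is kept
  abstract, as the image under the norm, so no surface area or radial density has to be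
  computed.\<close>

lemma nn_integral_polar:
  assumes N: "N \<ge> 1" and [measurable]: "\<Phi> \<in> borel_measurable (borel_pow N)" "\<rho> \<in> borel_measurable borel"
  shows "(\<integral>\<^sup>+x. \<rho> (norm_pow N x) * \<Phi> (sphere_proj N x) \<partial>measure_pow lborel N)
     = (\<integral>\<^sup>+x. \<rho> (norm_pow N x) \<partial>measure_pow lborel N) * (\<integral>\<^sup>+y. \<Phi> y \<partial>sphere_uniform N)"
proof -
  let ?L = "measure_pow lborel N" and ?\<sigma> = "sphere_uniform N"
  define R where "R = distr ?L borel (norm_pow N)"
  have spL: "space ?L = space (borel_pow N)" by (simp add: space_measure_pow space_PiM)
  interpret S: prob_space ?\<sigma> by (rule prob_space_sphere_uniform) fact
  have Rball: "emeasure R {..r} = emeasure ?L (pball N r)" for r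
    unfolding R_def by (subst emeasure_distr_pow[OF sets_measure_pow_lborel measurable_norm_pow])
      (simp_all add: pball_def)
  have "sigma_finite_measure R"
  proof
    show "\<exists>A. countable A \<and> A \<subseteq> sets R \<and> \<Union> A = space R \<and> (\<forall>a\<in>A. emeasure R a \<noteq> \<infinity>)"
    proof (intro exI[of _ "range (\<lambda>n::nat. {..real (Suc n)})"] conjI ballI)
      have "\<exists>n. x \<le> real (Suc n)" for x :: real
        using reals_Archimedean2[of x] by (meson less_imp_le less_trans of_nat_less_iff lessI)
      then show "\<Union> (range (\<lambda>n. {..real (Suc n)})) = space R" by (auto simp: R_def)
    next
      fix a assume "a \<in> range (\<lambda>n. {..real (Suc n)})"
      then show "emeasure R a \<noteq> \<infinity>" using emeasure_pball_nontrivial(2)[of _ N] by (auto simp: Rball simp del: of_nat_Suc)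
    qed (auto simp: R_def)
  qed
  have rect: "emeasure R A * emeasure ?\<sigma> B =
      emeasure ?L {x \<in> space (borel_pow N). norm_pow N x \<in> A \<and> sphere_proj N x \<in> B}"
    if A: "A \<in> sets borel" and B[measurable]: "B \<in> sets (borel_pow N)" for A B
  proof -
    have BS[measurable]: "{x \<in> space (borel_pow N). sphere_proj N x \<in> B} \<in> sets (borel_pow N)" by measurable
    \<comment> \<open>For a fixed set \<open>B\<close> of directions both sides of the rectangle
      identity are measures in \<open>A\<close>. It suffices to compare them on half-lines {..r},
      where the claim is the cone identity for balls.\<close>
    define N1 where "N1 = distr (density ?L (indicator {x \<in> space (borel_pow N). sphere_proj N x \<in> B})) borel (norm_pow N)"
    define N2 where "N2 = density R (\<lambda>_. emeasure ?\<sigma> B)"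
    have N1: "emeasure N1 A = emeasure ?L {x \<in> space (borel_pow N). norm_pow N x \<in> A \<and> sphere_proj N x \<in> B}"
      if [measurable]: "A \<in> sets borel" for A
    proof -
      have m: "{x \<in> space (borel_pow N). norm_pow N x \<in> A} \<in> sets (borel_pow N)" by measurable
      have "emeasure N1 A = emeasure (density ?L (indicator {x \<in> space (borel_pow N). sphere_proj N x \<in> B}))
          {x \<in> space (borel_pow N). norm_pow N x \<in> A}"
        unfolding N1_def by (rule emeasure_distr_pow) (simp_all add: sets_measure_pow_lborel)
      also have "\<dots> = emeasure ?L ({x \<in> space (borel_pow N). sphere_proj N x \<in> B} \<inter> {x \<in> space (borel_pow N). norm_pow N x \<in> A})"
        using m BS by (subst emeasure_density) (auto simp: sets_measure_pow indicator_inter_arith[symmetric])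
      also have "{x \<in> space (borel_pow N). sphere_proj N x \<in> B} \<inter> {x \<in> space (borel_pow N). norm_pow N x \<in> A}
          = {x \<in> space (borel_pow N). norm_pow N x \<in> A \<and> sphere_proj N x \<in> B}" by blast
      finally show ?thesis .
    qed
    have N2: "emeasure N2 A = emeasure R A * emeasure ?\<sigma> B" if "A \<in> sets borel" for A
      using that unfolding N2_def by (simp add: emeasure_density_const R_def mult.commute[of "emeasure ?\<sigma> B"])
    have ball: "emeasure N1 {..r} = emeasure R {..r} * emeasure ?\<sigma> B" for r
    proof -
      have "emeasure N1 {..r} = emeasure ?L {x \<in> pball N r. sphere_proj N x \<in> B}"
        by (subst N1) (simp_all add: pball_def conj_assoc)
      also have "\<dots> = emeasure ?L (pball N r) * emeasure ?\<sigma> B"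
      proof (cases "r > 0")
        case True then show ?thesis by (intro emeasure_sphere_uniform) (use N in auto)
      next
        case False
        have "emeasure ?L {x \<in> pball N r. sphere_proj N x \<in> B} \<le> emeasure ?L (pball N r)"
          by (intro emeasure_mono) (auto simp: sets_measure_pow_lborel)
        then show ?thesis using emeasure_pball_nonpos[OF N, of r] False by auto
      qed
      finally show ?thesis by (simp add: Rball)
    qed
    have "N1 = N2"
    proof (rule measure_eqI_generator_eq)
      show "Int_stable (range (\<lambda>a::real. {..a}))" by (auto simp: Int_stable_def)
      show "range (\<lambda>a. {..a}) \<subseteq> Pow (UNIV::real set)" by auto
      show "sets N1 = sigma_sets UNIV (range (\<lambda>a::real. {..a}))"
        unfolding N1_def by (simp add: borel_eq_atMost)
      show "sets N2 = sigma_sets UNIV (range (\<lambda>a::real. {..a}))"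
        unfolding N2_def R_def by (simp add: borel_eq_atMost)
      show "emeasure N1 X = emeasure N2 X" if "X \<in> range (\<lambda>a::real. {..a})" for X
        using that by (auto simp: ball N2)
      show "range (\<lambda>n::nat. {..real (Suc n)}) \<subseteq> range (\<lambda>a. {..a})" by auto
      have "\<exists>n. x \<le> real (Suc n)" for x :: real
        using reals_Archimedean2[of x] by (meson less_imp_le less_trans of_nat_less_iff lessI)
      then show "(\<Union>n::nat. {..real (Suc n)}) = UNIV" by auto
      fix n :: nat
      show "emeasure N1 {..real (Suc n)} \<noteq> \<infinity>"
        using emeasure_pball_nontrivial(2)[of "real (Suc n)" N] S.emeasure_finite[of B]
        by (auto simp: ball Rball ennreal_mult_eq_top_iff simp del: of_nat_Suc)
    qed
    then show ?thesis using N1[OF A] N2[OF A] by simp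
  qed
  define J where "J = distr ?L (borel \<Otimes>\<^sub>M borel_pow N) (\<lambda>x. (norm_pow N x, sphere_proj N x))"
  have mJ: "(\<lambda>x. (norm_pow N x, sphere_proj N x)) \<in> ?L \<rightarrow>\<^sub>M borel \<Otimes>\<^sub>M borel_pow N" by measurable
  have sJ: "sets (R \<Otimes>\<^sub>M ?\<sigma>) = sets (borel \<Otimes>\<^sub>M borel_pow N)"
    by (intro sets_pair_measure_cong) (auto simp: R_def)
  have "R \<Otimes>\<^sub>M ?\<sigma> = J"
  proof (rule pair_measure_eqI)
    show "sets (R \<Otimes>\<^sub>M ?\<sigma>) = sets J" using sJ by (simp add: J_def)
    fix A B assume A: "A \<in> sets R" and B: "B \<in> sets ?\<sigma>"
    then have AB: "A \<times> B \<in> sets (borel \<Otimes>\<^sub>M borel_pow N)" by (intro pair_measureI) (auto simp: R_def)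
    have "emeasure R A * emeasure ?\<sigma> B = emeasure ?L {x \<in> space (borel_pow N). norm_pow N x \<in> A \<and> sphere_proj N x \<in> B}"
      using A B by (intro rect) (auto simp: R_def)
    also have "\<dots> = emeasure J (A \<times> B)"
      unfolding J_def using AB by (subst emeasure_distr_pow[OF sets_measure_pow_lborel]) simp_all
    finally show "emeasure R A * emeasure ?\<sigma> B = emeasure J (A \<times> B)" .
  qed (fact, rule S.sigma_finite_measure_axioms)
  note eq = this
  have m2: "(\<lambda>z. \<rho> (fst z) * \<Phi> (snd z)) \<in> borel_measurable (borel \<Otimes>\<^sub>M borel_pow N)" by measurable
  have "(\<integral>\<^sup>+x. \<rho> (norm_pow N x) * \<Phi> (sphere_proj N x) \<partial>?L) = (\<integral>\<^sup>+z. \<rho> (fst z) * \<Phi> (snd z) \<partial>J)"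
    unfolding J_def using mJ m2 by (subst nn_integral_distr) auto
  also have "\<dots> = (\<integral>\<^sup>+r. \<integral>\<^sup>+y. \<rho> r * \<Phi> y \<partial>?\<sigma> \<partial>R)"
    unfolding eq[symmetric] using m2 sJ
    by (subst S.nn_integral_fst[symmetric]) (auto cong: measurable_cong_sets)
  also have "\<dots> = (\<integral>\<^sup>+r. \<rho> r * (\<integral>\<^sup>+y. \<Phi> y \<partial>?\<sigma>) \<partial>R)"
    by (intro nn_integral_cong nn_integral_cmult) (measurable)
  also have "\<dots> = (\<integral>\<^sup>+r. \<rho> r \<partial>R) * (\<integral>\<^sup>+y. \<Phi> y \<partial>?\<sigma>)"
    by (intro nn_integral_multc) (auto simp: R_def)
  also have "(\<integral>\<^sup>+r. \<rho> r \<partial>R) = (\<integral>\<^sup>+x. \<rho> (norm_pow N x) \<partial>?L)"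
    unfolding R_def by (subst nn_integral_distr) auto
  finally show ?thesis .
qed

section \<open>Powers of a density\<close>

lemma prob_space_measure_pow: "prob_space \<mu> \<Longrightarrow> prob_space (measure_pow \<mu> N)"
  unfolding measure_pow_def by (rule prob_space_PiM)

lemma measurable_component_borel_pow [measurable (raw)]:
  assumes "i < N" "f \<in> borel_measurable borel"
  shows "(\<lambda>x. f (x i)) \<in> borel_measurable (borel_pow N)"
  by (intro measurable_compose[OF _ assms(2)] measurable_component_singleton) (use assms(1) in simp)

lemma distr_measure_pow_component:
  assumes "prob_space \<mu>" "sets \<mu> = sets borel" "i < N"
  shows "distr (measure_pow \<mu> N) borel (\<lambda>x. x i) = \<mu>"
  using distr_PiM_component[of "{..<N}" "\<lambda>_. \<mu>" i] assms
  by (simp add: measure_pow_def cong: distr_cong)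

lemma
  fixes Y :: "real \<Rightarrow> real"
  assumes "prob_space \<mu>" "sets \<mu> = sets borel" "i < N" "Y \<in> borel_measurable borel"
  shows integrable_measure_pow_component:
      "integrable \<mu> Y \<Longrightarrow> integrable (measure_pow \<mu> N) (\<lambda>x. Y (x i))"
    and integral_measure_pow_component: "(\<integral>x. Y (x i) \<partial>measure_pow \<mu> N) = (\<integral>x. Y x \<partial>\<mu>)"
proof -
  have m: "(\<lambda>x. x i) \<in> measure_pow \<mu> N \<rightarrow>\<^sub>M borel"
    unfolding measurable_cong_sets[OF sets_measure_pow[OF assms(2)] refl] using assms(3) by measurable
  note D = distr_measure_pow_component[OF assms(1-3)]
  show "integrable \<mu> Y \<Longrightarrow> integrable (measure_pow \<mu> N) (\<lambda>x. Y (x i))"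
    using integrable_distr_eq[OF m, of Y] assms(4) by (simp add: D)
  show "(\<integral>x. Y (x i) \<partial>measure_pow \<mu> N) = (\<integral>x. Y x \<partial>\<mu>)"
    using integral_distr[OF m, of Y] assms(4) by (simp add: D)
qed

text \<open>Additivity of the variance for independent centred variables: expanding the square, the
  off-diagonal terms have mean zero.\<close>

lemma sum_square_measure_pow:
  fixes Y :: "real \<Rightarrow> real"
  assumes \<mu>: "prob_space \<mu>" "sets \<mu> = sets borel" and Y: "Y \<in> borel_measurable borel"
    and i1: "integrable \<mu> Y" and i2: "integrable \<mu> (\<lambda>x. (Y x)\<^sup>2)" and mean: "(\<integral>x. Y x \<partial>\<mu>) = 0"
  shows "has_bochner_integral (measure_pow \<mu> N) (\<lambda>x. (\<Sum>i<N. Y (x i))\<^sup>2) (real N * (\<integral>x. (Y x)\<^sup>2 \<partial>\<mu>))"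
proof -
  interpret prob_space \<mu> by fact
  interpret product_sigma_finite "\<lambda>_::nat. \<mu>" ..
  let ?P = "measure_pow \<mu> N"
  define v where "v = (\<integral>x. (Y x)\<^sup>2 \<partial>\<mu>)"
  have pair: "has_bochner_integral ?P (\<lambda>x. Y (x i) * Y (x j)) (if j = i then v else 0)"
    if "i < N" "j < N" for i j
  proof (cases "j = i")
    case True
    have "(\<lambda>x. (Y x)\<^sup>2) \<in> borel_measurable borel" using Y by measurable
    from integrable_measure_pow_component[OF \<mu> \<open>i < N\<close> this i2] integral_measure_pow_component[OF \<mu> \<open>i < N\<close> this]
    show ?thesis using True by (auto simp: has_bochner_integral_iff v_def power2_eq_square)
  next
    case False
    \<comment> \<open>The product of two coordinates is padded with factors 1 to a product over all
      coordinates, so that the product formula for integrals applies to it.\<close>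
    define g where "g l = (\<lambda>t. if l \<in> {i, j} then Y t else 1)" for l :: nat
    have eq: "(\<Prod>l<N. g l (x l)) = Y (x i) * Y (x j)" for x
    proof -
      have "(\<Prod>l<N. g l (x l)) = (\<Prod>l\<in>{..<N} \<inter> {i, j}. Y (x l))"
        unfolding g_def by (subst prod.inter_restrict) auto
      also have "{..<N} \<inter> {i, j} = {i, j}" using that by auto
      finally show ?thesis using False by simp
    qed
    have ig: "integrable \<mu> (g l)" for l using i1 by (cases "l \<in> {i, j}") (simp_all add: g_def cong: if_cong)
    have "(\<integral>x. (\<Prod>l<N. g l (x l)) \<partial>?P) = (\<Prod>l<N. \<integral>x. g l x \<partial>\<mu>)"
      unfolding measure_pow_def by (rule product_integral_prod) (auto intro: ig)
    also have "\<dots> = 0" using that mean by (intro prod_zero) (auto intro!: bexI[of _ i] simp: g_def)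
    finally have "(\<integral>x. Y (x i) * Y (x j) \<partial>?P) = 0" by (simp add: eq)
    moreover have "integrable ?P (\<lambda>x. \<Prod>l<N. g l (x l))"
      unfolding measure_pow_def by (rule product_integrable_prod) (auto intro: ig)
    then have "integrable ?P (\<lambda>x. Y (x i) * Y (x j))" by (simp add: eq)
    ultimately show ?thesis using False by (simp add: has_bochner_integral_iff)
  qed
  have "has_bochner_integral ?P (\<lambda>x. \<Sum>i<N. \<Sum>j<N. Y (x i) * Y (x j)) (\<Sum>i<N. \<Sum>j<N. if j = i then v else 0)"
    by (intro has_bochner_integral_sum pair) auto
  also have "(\<Sum>i<N. \<Sum>j<N. if j = i then v else 0) = real N * v" by simp
  finally show ?thesis by (simp add: power2_eq_square sum_product v_def)
qed

lemma measure_pow_density: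
  fixes d :: "real \<Rightarrow> real"
  assumes [measurable]: "d \<in> borel_measurable borel" and nn: "\<And>x. 0 \<le> d x"
    and p: "prob_space (density lborel d)"
  shows "measure_pow (density lborel d) N = density (measure_pow lborel N) (\<lambda>x. \<Prod>i<N. d (x i))"
proof -
  interpret P: prob_space "density lborel d" by fact
  interpret D: product_sigma_finite "\<lambda>_::nat. density lborel d" ..
  interpret L: product_sigma_finite "\<lambda>_::nat. lborel :: real measure" ..
  have "density (measure_pow lborel N) (\<lambda>x. \<Prod>i<N. d (x i)) = PiM {..<N} (\<lambda>_. density lborel d)"
  proof (rule D.PiM_eqI)
    show "sets (density (measure_pow lborel N) (\<lambda>x. ennreal (\<Prod>i<N. d (x i)))) = sets (PiM {..<N} (\<lambda>_. density lborel d))"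
      using sets_measure_pow_lborel[of N] sets_measure_pow_density[of d N] by (simp add: measure_pow_def)
    fix A :: "nat \<Rightarrow> real set" assume "\<And>i. i \<in> {..<N} \<Longrightarrow> A i \<in> sets (density lborel d)"
    then have A: "A i \<in> sets borel" if "i < N" for i using that by auto
    then have PA: "Pi\<^sub>E {..<N} A \<in> sets (measure_pow lborel N)"
      unfolding sets_measure_pow_lborel by (intro sets_PiM_I_finite) auto
    have m: "(\<lambda>x. ennreal (\<Prod>i<N. d (x i))) \<in> borel_measurable (measure_pow lborel N)" by measurable
    have "emeasure (density (measure_pow lborel N) (\<lambda>x. \<Prod>i<N. d (x i))) (Pi\<^sub>E {..<N} A)
      = (\<integral>\<^sup>+x. ennreal (\<Prod>i<N. d (x i)) * indicator (Pi\<^sub>E {..<N} A) x \<partial>measure_pow lborel N)"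
      by (rule emeasure_density[OF m PA])
    also have "\<dots> = (\<integral>\<^sup>+x. (\<Prod>i<N. ennreal (d (x i)) * indicator (A i) (x i)) \<partial>measure_pow lborel N)"
    proof (rule nn_integral_cong)
      fix x assume "x \<in> space (measure_pow lborel N)"
      then have x: "x \<in> extensional {..<N}" by (simp add: space_measure_pow PiE_iff)
      have "(\<Prod>i<N. indicator (A i) (x i)) = (indicator (Pi\<^sub>E {..<N} A) x :: ennreal)"
        using x by (cases "x \<in> Pi\<^sub>E {..<N} A") (force simp: PiE_iff intro!: prod.neutral prod_zero)+
      then show "ennreal (\<Prod>i<N. d (x i)) * indicator (Pi\<^sub>E {..<N} A) x
          = (\<Prod>i<N. ennreal (d (x i)) * indicator (A i) (x i))"
        by (simp add: prod.distrib prod_ennreal nn)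
    qed
    also have "\<dots> = (\<Prod>i<N. \<integral>\<^sup>+x. ennreal (d x) * indicator (A i) x \<partial>lborel)"
      unfolding measure_pow_def by (rule L.product_nn_integral_prod) (use A in auto)
    also have "\<dots> = (\<Prod>i<N. emeasure (density lborel d) (A i))"
      using A by (intro prod.cong) (auto simp: emeasure_density)
    finally show "emeasure (density (measure_pow lborel N) (\<lambda>x. \<Prod>i<N. d (x i))) (Pi\<^sub>E {..<N} A)
       = (\<Prod>i\<in>{..<N}. emeasure (density lborel d) (A i))" .
  qed simp
  then show ?thesis by (simp add: measure_pow_def)
qed

section \<open>Polar coordinates for the Gaussian measure\<close>

lemma prod_std_normal_density:
  "(\<Prod>i<N. std_normal_density (x i)) = (1 / sqrt (2 * pi)) ^ N * exp (- (norm_pow N x)\<^sup>2 / 2)"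
  by (simp add: normal_density_def prod.distrib exp_sum[symmetric] norm_pow_sq sum_negf sum_divide_distrib prod_dividef power_one_over)

lemma prob_space_std_normal: "prob_space (density lborel std_normal_density)"
  by (rule prob_space_normal_density) simp

text \<open>The Gaussian weight is a function of the radius alone, so it is absorbed into the radial
  factor of the Lebesgue formula.\<close>

lemma nn_integral_polar_normal:
  assumes N: "N \<ge> 1" and [measurable]: "\<Phi> \<in> borel_measurable (borel_pow N)" "\<rho> \<in> borel_measurable borel"
  shows "(\<integral>\<^sup>+x. \<rho> (norm_pow N x) * \<Phi> (sphere_proj N x) \<partial>measure_pow (density lborel std_normal_density) N)
     = (\<integral>\<^sup>+x. \<rho> (norm_pow N x) \<partial>measure_pow (density lborel std_normal_density) N) * (\<integral>\<^sup>+y. \<Phi> y \<partial>sphere_uniform N)"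
proof -
  define w where "w r = ennreal ((1 / sqrt (2 * pi)) ^ N * exp (- r\<^sup>2 / 2))" for r :: real
  have w[measurable]: "w \<in> borel_measurable borel" unfolding w_def by measurable
  have G: "measure_pow (density lborel std_normal_density) N = density (measure_pow lborel N) (\<lambda>x. w (norm_pow N x))"
    using measure_pow_density[OF _ _ prob_space_std_normal, of N]
    by (simp add: prod_std_normal_density w_def)
  have 1: "(\<integral>\<^sup>+x. \<phi> x \<partial>measure_pow (density lborel std_normal_density) N)
     = (\<integral>\<^sup>+x. w (norm_pow N x) * \<phi> x \<partial>measure_pow lborel N)" if "\<phi> \<in> borel_measurable (borel_pow N)" for \<phi>
    unfolding G using that by (intro nn_integral_density) measurable
  show ?thesis
    using nn_integral_polar[OF N assms(2), of "\<lambda>r. w r * \<rho> r"]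
    by (subst (1 2) 1) (measurable, simp add: mult.assoc)
qed

text \<open>The case of radial factor 1: the uniform measure of the sphere is the image of the
  Gaussian power under the projection. This is how the Gaussian reference measure and the sphere are
  linked in both entropy bounds.\<close>

lemma nn_integral_sphere_proj_normal:
  assumes N: "N \<ge> 1" and [measurable]: "\<Phi> \<in> borel_measurable (borel_pow N)"
  shows "(\<integral>\<^sup>+x. \<Phi> (sphere_proj N x) \<partial>measure_pow (density lborel std_normal_density) N) = (\<integral>\<^sup>+y. \<Phi> y \<partial>sphere_uniform N)"
proof -
  interpret prob_space "measure_pow (density lborel std_normal_density) N"
    by (intro prob_space_measure_pow prob_space_std_normal)
  show ?thesis using nn_integral_polar_normal[OF N assms(2), of "\<lambda>_. 1"] by (simp add: emeasure_space_1)
qed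

section \<open>Consequences of finite Fisher information\<close>

lemma std_normal_density_has_real_derivative:
  "(std_normal_density has_real_derivative - x * std_normal_density x) (at x)"
proof -
  have "((\<lambda>x. c * exp (- x\<^sup>2 / 2)) has_real_derivative - x * (c * exp (- x\<^sup>2 / 2))) (at x)" for c :: real
    by (auto intro!: derivative_eq_intros)
  from this[of "1 / sqrt (2 * pi)"] show ?thesis by (simp add: normal_density_def[abs_def])
qed

text \<open>A Cauchy-Schwarz argument with a free parameter c. Young's inequality bounds |f'| by c
  times a fixed integrable function plus f / (2c). Integrating over an interval with c = 1 bounds
  \<open>f\<close>; feeding this bound back and taking c as the square root of the length gives the
  Hoelder estimate.\<close>

lemma fisher_information_imp_bounded_Holder:
  fixes f :: "real \<Rightarrow> real"
  assumes f_meas[measurable]: "f \<in> borel_measurable borel" and nn: "\<And>x. 0 \<le> f x"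
    and f1: "(\<integral>\<^sup>+x. ennreal (f x) \<partial>lborel) = 1"
    and f2: "integrable lborel (\<lambda>x. x\<^sup>2 * f x)"
    and fisher: "fisher_information_std_normal f < \<infinity>"
  obtains M where "\<And>x. f x \<le> M" "\<And>a b. \<bar>f a - f b\<bar> \<le> M * sqrt \<bar>a - b\<bar>"
proof -
  define \<phi> where "\<phi> = (std_normal_density :: real \<Rightarrow> real)"
  have \<phi>_pos: "\<phi> x > 0" for x by (simp add: \<phi>_def normal_density_pos)
  define h where "h x = f x / \<phi> x" for x
  have h_nn: "h x \<ge> 0" for x using nn[of x] \<phi>_pos[of x] by (simp add: h_def)
  have f_h: "f x = h x * \<phi> x" for x using \<phi>_pos[of x] by (simp add: h_def)
  have C1: "h C1_differentiable_on UNIV"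
    and fin: "(\<integral>\<^sup>+x. ennreal (\<bar>deriv h x\<bar>\<^sup>2 / h x * \<phi> x) \<partial>lborel) < \<infinity>"
    using fisher by (auto simp: fisher_information_std_normal_def h_def[abs_def] \<phi>_def Let_def split: if_splits)
  obtain D where D: "\<And>x. (h has_real_derivative D x) (at x)" and Dc: "continuous_on UNIV D"
    using C1 by (auto simp: C1_differentiable_on_def has_real_derivative_iff_has_vector_derivative)
  have [measurable]: "D \<in> borel_measurable borel" using Dc by (rule borel_measurable_continuous_onI)
  have [measurable]: "\<phi> \<in> borel_measurable borel" by (simp add: \<phi>_def)
  have [measurable]: "h \<in> borel_measurable borel" unfolding h_def by measurable
  have deriv_h: "deriv h x = D x" for x using D by (rule DERIV_imp_deriv)
  \<comment> \<open>From f = h \<phi> with \<phi>' = -x \<phi>; the second term is what makes the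
    second moment appear beside the Fisher information in \<open>w\<close>.\<close>
  define f' where "f' x = D x * \<phi> x - x * f x" for x
  have f': "(f has_real_derivative f' x) (at x)" for x
  proof -
    have "((\<lambda>x. h x * \<phi> x) has_real_derivative D x * \<phi> x + (- x * \<phi> x) * h x) (at x)"
      unfolding \<phi>_def by (intro DERIV_mult D std_normal_density_has_real_derivative)
    then show ?thesis by (simp add: f_h[abs_def] f'_def algebra_simps)
  qed
  have f_cont: "continuous_on UNIV f" using f' by (meson DERIV_isCont continuous_at_imp_continuous_on)
  have \<phi>_cont: "continuous_on UNIV \<phi>"
    unfolding \<phi>_def by (meson DERIV_isCont continuous_at_imp_continuous_on std_normal_density_has_real_derivative)
  have f'_cont: "continuous_on UNIV f'"
    unfolding f'_def by (intro continuous_intros Dc f_cont \<phi>_cont)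
  define u where "u x = (D x)\<^sup>2 / h x * \<phi> x" for x
  have u_nn: "u x \<ge> 0" for x using h_nn[of x] \<phi>_pos[of x] by (simp add: u_def)
  have [measurable]: "u \<in> borel_measurable borel" unfolding u_def by measurable
  have u_int: "integrable lborel u"
    using fin u_nn by (intro integrableI_nonneg) (auto simp: u_def deriv_h)
  define w where "w x = u x + x\<^sup>2 * f x" for x
  have w_int: "integrable lborel w" unfolding w_def by (intro Bochner_Integration.integrable_add u_int f2)
  have w_nn: "w x \<ge> 0" for x using u_nn[of x] nn[of x] by (simp add: w_def)
  have f_int: "integrable lborel f" using f1 nn by (intro integrableI_nonneg) auto
  define J where "J = (\<integral>x. w x \<partial>lborel)"
  have J_nn: "J \<ge> 0" unfolding J_def using w_nn by simp
  have pt: "\<bar>f' x\<bar> \<le> c * w x + f x / (2 * c)" if c: "c > 0" for c x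
  proof -
    have am: "s * t \<le> c * s\<^sup>2 + t\<^sup>2 / (4 * c)" for s t :: real
    proof -
      have "0 \<le> (2 * c * s - t)\<^sup>2 / (4 * c)" using c by simp
      also have "\<dots> = c * s\<^sup>2 + t\<^sup>2 / (4 * c) - s * t"
        using c by (simp add: power2_eq_square field_simps)
      finally show ?thesis by simp
    qed
    have 2: "\<bar>x\<bar> * f x \<le> c * (x\<^sup>2 * f x) + f x / (4 * c)"
      using mult_right_mono[OF am[of "\<bar>x\<bar>" 1] nn[of x]] by (simp add: algebra_simps)
    have 1: "\<bar>D x\<bar> * \<phi> x \<le> c * u x + f x / (4 * c)"
    proof (cases "h x = 0")
      case True
      \<comment> \<open>A zero of the nonnegative function \<open>h\<close> is a minimum, so the
        derivative vanishes there and the quotient by zero in \<open>u\<close> does no harm.\<close>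
      have "D x = 0"
        by (rule DERIV_local_min[OF D, of 1]) (use True h_nn in auto)
      then show ?thesis using c u_nn[of x] nn[of x] by simp
    next
      case False
      then have h: "h x > 0" using h_nn[of x] by simp
      have "\<bar>D x\<bar> * \<phi> x = (\<bar>D x\<bar> / h x * 1) * f x" using h by (simp add: f_h)
      also have "\<dots> \<le> (c * (\<bar>D x\<bar> / h x)\<^sup>2 + 1\<^sup>2 / (4 * c)) * f x"
        by (rule mult_right_mono[OF am nn])
      also have "\<dots> = c * u x + f x / (4 * c)"
        using h c by (simp add: u_def f_h power2_eq_square field_simps)
      finally show ?thesis .
    qed
    have "\<bar>f' x\<bar> \<le> \<bar>D x\<bar> * \<phi> x + \<bar>x\<bar> * f x"
      using abs_triangle_ineq4[of "D x * \<phi> x" "x * f x"] \<phi>_pos[of x] nn[of x] by (simp add: f'_def abs_mult)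
    also have "\<dots> \<le> c * (u x + x\<^sup>2 * f x) + f x / (2 * c)" using 1 2 by (simp add: algebra_simps)
    finally show ?thesis by (simp add: w_def)
  qed
  have incr: "\<bar>f b - f a\<bar> \<le> c * J + (\<integral>x. f x * indicator {a..b} x \<partial>lborel) / (2 * c)"
    if c: "c > 0" and "a \<le> b" for a b c
  proof -
    have fi: "integrable lborel (\<lambda>x. f x * indicator {a..b} x)"
      using f_int by (intro integrable_real_mult_indicator) auto
    have "has_bochner_integral lborel (\<lambda>x. f' x * indicator {a..b} x) (f b - f a)"
      using \<open>a \<le> b\<close> f' f'_cont by (intro has_bochner_integral_FTC_Icc_real) (auto simp: continuous_on_eq_continuous_at)
    then have "\<bar>f b - f a\<bar> = \<bar>\<integral>x. f' x * indicator {a..b} x \<partial>lborel\<bar>"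
      by (simp add: has_bochner_integral_integral_eq)
    also have "\<dots> \<le> (\<integral>x. c * w x + f x * indicator {a..b} x / (2 * c) \<partial>lborel)"
    proof (rule integral_abs_bound[THEN order_trans], rule integral_mono')
      show "integrable lborel (\<lambda>x. c * w x + f x * indicator {a..b} x / (2 * c))"
        using w_int fi by simp
      fix x
      show "\<bar>f' x * indicator {a..b} x\<bar> \<le> c * w x + f x * indicator {a..b} x / (2 * c)"
        using pt[OF c, of x] w_nn[of x] c by (auto simp: indicator_def)
      show "0 \<le> c * w x + f x * indicator {a..b} x / (2 * c)"
        using w_nn[of x] nn[of x] c by (auto simp: indicator_def)
    qed
    also have "\<dots> = c * J + (\<integral>x. f x * indicator {a..b} x \<partial>lborel) / (2 * c)"
      using w_int fi by (simp add: J_def)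
    finally show ?thesis .
  qed
  have f_le1: "(\<integral>x. f x * indicator {a..b} x \<partial>lborel) \<le> 1" for a b
  proof -
    have "(\<integral>x. f x * indicator {a..b} x \<partial>lborel) \<le> (\<integral>x. f x \<partial>lborel)"
      by (rule integral_mono') (use f_int nn in \<open>auto simp: indicator_def\<close>)
    also have "\<dots> = 1" using f1 nn by (subst integral_eq_nn_integral) auto
    finally show ?thesis .
  qed
  define M0 where "M0 = J + 3 / 2"
  have bd: "f x \<le> M0" for x
  proof -
    \<comment> \<open>A function above 1 everywhere would have infinite integral, so there is a base
      point from which the oscillation bound turns into a bound on values.\<close>
    obtain y where y: "f y \<le> 1"
    proof (rule ccontr)
      assume "\<not> thesis"
      then have "f y > 1" for y using that by (meson not_le)
      then have "(\<integral>\<^sup>+x. 1 \<partial>(lborel :: real measure)) \<le> (\<integral>\<^sup>+x. ennreal (f x) \<partial>lborel)"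
        by (intro nn_integral_mono) (auto simp: less_imp_le)
      then show False using f1 by (simp add: top_unique)
    qed
    have "\<bar>f x - f y\<bar> \<le> J + 1 / 2"
      using incr[of 1 x y] incr[of 1 y x] f_le1[of x y] f_le1[of y x] by (cases "x \<le> y") (auto simp: abs_minus_commute)
    then show ?thesis using y by (simp add: M0_def)
  qed
  have hol: "\<bar>f b - f a\<bar> \<le> (J + M0) * sqrt (b - a)" if "a < b" for a b
  proof -
    \<comment> \<open>With this choice c J and M0 (b - a) / (2c) are both of order sqrt (b -
      a).\<close>
    define c where "c = sqrt (b - a)"
    have c: "c > 0" "b - a = c * c" using that by (auto simp: c_def)
    have "(\<integral>x. f x * indicator {a..b} x \<partial>lborel) \<le> (\<integral>x. M0 * indicator {a..b} x \<partial>lborel)"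
    proof (rule integral_mono')
      show "integrable lborel (\<lambda>x. M0 * indicator {a..b} x)"
        by (intro integrable_mult_right integrable_real_indicator) (auto simp: emeasure_lborel_Icc_eq)
    qed (use bd J_nn in \<open>auto simp: indicator_def M0_def\<close>)
    also have "\<dots> = M0 * (b - a)" using that by simp
    finally have "(\<integral>x. f x * indicator {a..b} x \<partial>lborel) / (2 * c) \<le> M0 * (c * c) / (2 * c)"
      using c by (intro divide_right_mono) auto
    also have "\<dots> = M0 / 2 * c" using c by simp
    also have "\<dots> \<le> M0 * c" using c J_nn by (intro mult_right_mono) (auto simp: M0_def)
    finally show ?thesis using incr[OF c(1), of a b] that by (simp add: c_def[symmetric] algebra_simps)
  qed
  show thesis
  proof
    show "f x \<le> J + M0" for x using bd[of x] J_nn by simp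
    show "\<bar>f a - f b\<bar> \<le> (J + M0) * sqrt \<bar>a - b\<bar>" for a b
      using hol[of a b] hol[of b a] by (cases a b rule: linorder_cases) (auto simp: abs_minus_commute)
  qed
qed

text \<open>The decay rate of this density makes \<open>sqrt \<bar>x\<bar> / tail_density x\<close> comparable to
  \<open>1 + x\<^sup>2\<close>, whose sum over the coordinates is constant on the sphere.\<close>

definition tail_density :: "real \<Rightarrow> real" where
  "tail_density x = (1 / sqrt (1 + \<bar>x\<bar>)) ^ 3 / 4"

lemma measurable_tail_density [measurable]: "tail_density \<in> borel_measurable borel"
  unfolding tail_density_def by measurable

lemma tail_density_pos: "0 < tail_density x"
  by (simp add: tail_density_def)

lemma tail_density_le: "tail_density x \<le> 1"
proof -
  have "(1 / sqrt (1 + \<bar>x\<bar>)) ^ 3 \<le> 1 ^ 3" by (intro power_mono) auto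
  then show ?thesis by (simp add: tail_density_def)
qed

text \<open>The function 1 / sqrt (1 + |x|) is itself Hoelder of exponent 1/2, because |r - s|^2
  \<le> |r^2 - s^2| for nonnegative r and s. Its cube loses a factor of at most 3, which the
  division by 4 absorbs.\<close>

lemma tail_density_Holder: "\<bar>tail_density a - tail_density b\<bar> \<le> sqrt \<bar>a - b\<bar>"
proof -
  define r s where "r = 1 / sqrt (1 + \<bar>a\<bar>)" and "s = 1 / sqrt (1 + \<bar>b\<bar>)"
  have r: "0 < r" "r \<le> 1" and s: "0 < s" "s \<le> 1" by (auto simp: r_def s_def)
  have p: "1 \<le> (1 + \<bar>a\<bar>) * (1 + \<bar>b\<bar>)" using mult_mono[of 1 "1 + \<bar>a\<bar>" 1 "1 + \<bar>b\<bar>"] by simp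
  have "\<bar>r - s\<bar>\<^sup>2 = \<bar>r - s\<bar> * \<bar>r - s\<bar>" by (rule power2_eq_square)
  also have "\<dots> \<le> \<bar>r - s\<bar> * (r + s)" using r s by (intro mult_left_mono) auto
  also have "\<dots> = \<bar>r\<^sup>2 - s\<^sup>2\<bar>" using r s by (simp add: abs_mult power2_eq_square square_diff_square_factored)
  also have "r\<^sup>2 - s\<^sup>2 = (\<bar>b\<bar> - \<bar>a\<bar>) / ((1 + \<bar>a\<bar>) * (1 + \<bar>b\<bar>))"
    by (simp add: r_def s_def power_divide field_simps)
  also have "\<bar>\<dots>\<bar> \<le> \<bar>\<bar>b\<bar> - \<bar>a\<bar>\<bar> / 1"
    using p unfolding abs_divide by (intro divide_left_mono) auto
  also have "\<dots> \<le> \<bar>a - b\<bar>" by simp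
  finally have rs: "\<bar>r - s\<bar> \<le> sqrt \<bar>a - b\<bar>" by (simp add: real_le_rsqrt)
  have "\<bar>tail_density a - tail_density b\<bar> = \<bar>r - s\<bar> * (r\<^sup>2 + r * s + s\<^sup>2) / 4"
  proof -
    have "r ^ 3 - s ^ 3 = (r - s) * (r\<^sup>2 + r * s + s\<^sup>2)" by (simp add: power2_eq_square power3_eq_cube algebra_simps)
    moreover have "r\<^sup>2 + r * s + s\<^sup>2 \<ge> 0" using r s by simp
    ultimately show ?thesis
      by (simp add: tail_density_def r_def[symmetric] s_def[symmetric] diff_divide_distrib[symmetric] abs_mult)
  qed
  also have "\<dots> \<le> \<bar>r - s\<bar> * (1 + 1 + 1) / 4"
    using r s by (intro divide_right_mono mult_left_mono add_mono mult_le_one power_le_one) auto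
  also have "\<dots> \<le> \<bar>r - s\<bar>" by simp
  finally show ?thesis using rs by simp
qed

text \<open>Each half-line carries mass 1/2, by the antiderivative -1 / (2 sqrt (1 + x)). This fixes
  the factor 1/4 in \<open>tail_density\<close>.\<close>

lemma nn_integral_tail_density: "(\<integral>\<^sup>+x. ennreal (tail_density x) \<partial>lborel) = 1"
proof -
  have half: "(\<integral>\<^sup>+x. ennreal (tail_density x) * indicator {0..} x \<partial>lborel) = ennreal (1 / 2)"
  proof -
    have "(\<integral>\<^sup>+x. ennreal (tail_density x) * indicator {0..} x \<partial>lborel) = ennreal (0 - (- 1 / 2 / sqrt (1 + 0)))"
    proof (rule nn_integral_FTC_atLeast)
      fix x :: real assume "0 \<le> x"
      then show "((\<lambda>x. - 1 / 2 / sqrt (1 + x)) has_real_derivative tail_density x) (at x)"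
        by (auto intro!: derivative_eq_intros simp: tail_density_def field_simps power3_eq_cube)
      show "0 \<le> tail_density x" by (rule less_imp_le[OF tail_density_pos])
    next
      show "((\<lambda>x. - 1 / 2 / sqrt (1 + x)) \<longlongrightarrow> 0) at_top"
        by real_asymp
    qed simp
    then show ?thesis by simp
  qed
  have "(\<integral>\<^sup>+x. ennreal (tail_density x) * indicator {..0} x \<partial>lborel) = ennreal (1 / 2)"
    using half by (subst nn_integral_real_affine[of _ "-1" 0]) (auto simp: tail_density_def indicator_def)
  note half' = this
  have "(\<integral>\<^sup>+x. ennreal (tail_density x) \<partial>lborel) =
     (\<integral>\<^sup>+x. ennreal (tail_density x) * indicator {0..} x + ennreal (tail_density x) * indicator {..0} x \<partial>lborel)"
  proof (rule nn_integral_cong_AE)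
    show "AE x in lborel. ennreal (tail_density x) =
      ennreal (tail_density x) * indicator {0..} x + ennreal (tail_density x) * indicator {..0} x"
      \<comment> \<open>The two closed half-lines overlap in the origin, which is a null
        set.\<close>
      using AE_lborel_singleton[of "0::real"] by eventually_elim (auto simp: indicator_def)
  qed
  also have "\<dots> = ennreal (1 / 2) + ennreal (1 / 2)"
    by (subst nn_integral_add) (simp_all only: half half', measurable)
  also have "\<dots> = 1" by (subst ennreal_plus[symmetric]) simp_all
  finally show ?thesis .
qed

section \<open>Variation of the logarithm under projection\<close>

text \<open>At both points \<phi> is at least \<open>m\<close>, of order \<epsilon> T^(-3/2), and ln
  has Lipschitz constant 1/m above \<open>m\<close>. The Hoelder numerator is at most L sqrt (s T),
  so the quotient is quadratic in T. The factor 12 is 4, from the normalisation of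
  \<open>tail_density\<close>, times 3, from comparing T^2 with 1 + a^2 + b^2.\<close>

lemma abs_ln_diff_le_Holder:
  fixes \<phi> :: "real \<Rightarrow> real"
  assumes Holder: "\<And>a b. \<bar>\<phi> a - \<phi> b\<bar> \<le> L * sqrt \<bar>a - b\<bar>" and "L \<ge> 0" and "\<epsilon> > 0"
    and lower: "\<And>x. \<epsilon> * tail_density x \<le> \<phi> x"
    and s: "\<bar>a - b\<bar> \<le> s * \<bar>a\<bar>" "s \<ge> 0"
  shows "\<bar>ln (\<phi> a) - ln (\<phi> b)\<bar> \<le> 12 * L / \<epsilon> * sqrt s * (1 + a\<^sup>2 + b\<^sup>2)"
proof -
  define T where "T = 1 + \<bar>a\<bar> + \<bar>b\<bar>"
  define m where "m = \<epsilon> / (4 * sqrt T ^ 3)"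
  have T: "T \<ge> 1" by (simp add: T_def)
  have m_pos: "m > 0" using T \<open>\<epsilon> > 0\<close> by (simp add: m_def)
  have m_le: "m \<le> \<phi> x" if "1 + \<bar>x\<bar> \<le> T" for x
  proof -
    have "m = \<epsilon> * ((1 / sqrt T) ^ 3 / 4)" by (simp add: m_def power_divide)
    also have "\<dots> \<le> \<epsilon> * tail_density x"
      unfolding tail_density_def using that T \<open>\<epsilon> > 0\<close>
      by (intro mult_left_mono divide_right_mono power_mono frac_le) auto
    finally show ?thesis using lower[of x] by simp
  qed
  have ln_le: "ln u - ln v \<le> \<bar>u - v\<bar> / m" if "m \<le> u" "m \<le> v" for u v
  proof -
    have "ln u - ln v = ln (u / v)" using that m_pos by (subst ln_div) auto
    also have "\<dots> \<le> u / v - 1" using that m_pos by (intro ln_le_minus_one) auto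
    also have "\<dots> = (u - v) / v" using that m_pos by (simp add: field_simps)
    also have "\<dots> \<le> \<bar>u - v\<bar> / m" using that m_pos by (intro frac_le) auto
    finally show ?thesis .
  qed
  have "\<bar>ln (\<phi> a) - ln (\<phi> b)\<bar> \<le> \<bar>\<phi> a - \<phi> b\<bar> / m"
    using ln_le[of "\<phi> a" "\<phi> b"] ln_le[of "\<phi> b" "\<phi> a"] m_le[of a] m_le[of b]
    by (auto simp: T_def abs_le_iff abs_minus_commute)
  also have "\<dots> \<le> (L * (sqrt s * sqrt T)) / m"
  proof (intro divide_right_mono order_trans[OF Holder] mult_left_mono)
    have "\<bar>a - b\<bar> \<le> s * T" using s by (rule_tac order_trans[OF s(1)] mult_left_mono)+ (auto simp: T_def)
    then show "sqrt \<bar>a - b\<bar> \<le> sqrt s * sqrt T" by (simp add: real_sqrt_mult[symmetric])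
  qed (use m_pos \<open>L \<ge> 0\<close> in auto)
  also have "\<dots> = 4 * L / \<epsilon> * sqrt s * T\<^sup>2"
  proof -
    have "sqrt T * sqrt T ^ 3 = (sqrt T)\<^sup>2 * (sqrt T)\<^sup>2"
      by (simp only: power2_eq_square power3_eq_cube mult.assoc)
    also have "\<dots> = T\<^sup>2" using T by (simp add: power2_eq_square[of T])
    finally have "4 * L / \<epsilon> * sqrt s * T\<^sup>2 = 4 * L / \<epsilon> * sqrt s * (sqrt T * sqrt T ^ 3)" by simp
    then show ?thesis using \<open>\<epsilon> > 0\<close> T by (auto simp add: m_def)
  qed
  also have "\<dots> \<le> 4 * L / \<epsilon> * sqrt s * (3 * (1 + a\<^sup>2 + b\<^sup>2))"
  proof (intro mult_left_mono)
    \<comment> \<open>Cauchy-Schwarz for the three terms of T, with the deficit written out as a sum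
      of squares.\<close>
    have "T\<^sup>2 + (1 - \<bar>a\<bar>)\<^sup>2 + (1 - \<bar>b\<bar>)\<^sup>2 + (\<bar>a\<bar> - \<bar>b\<bar>)\<^sup>2 = 3 * (1 + \<bar>a\<bar>\<^sup>2 + \<bar>b\<bar>\<^sup>2)"
      unfolding T_def power2_eq_square by (simp add: algebra_simps)
    then show "T\<^sup>2 \<le> 3 * (1 + a\<^sup>2 + b\<^sup>2)"
      using zero_le_power2[of "1 - \<bar>a\<bar>"] zero_le_power2[of "1 - \<bar>b\<bar>"] zero_le_power2[of "\<bar>a\<bar> - \<bar>b\<bar>"]
      unfolding power2_abs by linarith
  qed (use \<open>L \<ge> 0\<close> \<open>\<epsilon> > 0\<close> s in auto)
  also have "\<dots> = 12 * L / \<epsilon> * sqrt s * (1 + a\<^sup>2 + b\<^sup>2)" by simp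
  finally show ?thesis .
qed

text \<open>Each coordinate moves by the same relative amount |1 - u|, so the previous bound applies
  with a common s, and its quadratic factors sum to (2 + u^2) N. In terms of the rescaled deviation
  \<open>z\<close> the sum carries N * N^(-1/4) = N^(3/4). The dependence on \<open>z\<close> is
  weakened to 1 + z^2, because the second moment of \<open>z\<close> is the quantity that can be
  averaged under a product measure.\<close>

lemma sum_ln_sphere_proj_diff_le:
  fixes \<phi> :: "real \<Rightarrow> real"
  assumes Holder: "\<And>a b. \<bar>\<phi> a - \<phi> b\<bar> \<le> L * sqrt \<bar>a - b\<bar>" and "L \<ge> 0" and "\<epsilon> > 0"
    and lower: "\<And>x. \<epsilon> * tail_density x \<le> \<phi> x"
    and N: "N \<ge> 1" and x: "norm_pow N x \<noteq> 0"
  shows "\<bar>(\<Sum>i<N. ln (\<phi> (sphere_proj N x i))) - (\<Sum>i<N. ln (\<phi> (x i)))\<bar>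
    \<le> 48 * L / \<epsilon> * real N powr (3 / 4) * (1 + real N * (1 - (norm_pow N x)\<^sup>2 / real N)\<^sup>2)"
proof -
  define u where "u = norm_pow N x / sqrt N"
  define y where "y = sphere_proj N x"
  have u_pos: "u > 0" using x N norm_pow_nonneg[of N x] by (auto simp: u_def)
  have u2: "u\<^sup>2 = (norm_pow N x)\<^sup>2 / N" by (simp add: u_def power_divide)
  have xy: "x i = u * y i" if "i < N" for i
    using that x N by (simp add: u_def y_def sphere_proj_def)
  \<comment> \<open>The deviation on the scale of the central limit theorem: for independent
    coordinates with second moment 1 and finite fourth moment, the mean of z^2 is independent of
    N.\<close>
  define z where "z = sqrt N * \<bar>1 - u\<^sup>2\<bar>"
  have z: "z \<ge> 0" by (simp add: z_def)
  have le: "\<bar>1 - u\<bar> \<le> \<bar>1 - u\<^sup>2\<bar>"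
  proof -
    have "\<bar>1 - u\<bar> * 1 \<le> \<bar>1 - u\<bar> * (1 + u)" using u_pos by (intro mult_left_mono) auto
    also have "\<dots> = \<bar>1 - u\<^sup>2\<bar>" 
    proof -
      have "1 - u\<^sup>2 = (1 - u) * (1 + u)" by (simp add: power2_eq_square algebra_simps)
      then show ?thesis using u_pos by (simp add: abs_mult)
    qed
    finally show ?thesis by simp
  qed
  have "\<bar>(\<Sum>i<N. ln (\<phi> (y i))) - (\<Sum>i<N. ln (\<phi> (x i)))\<bar> \<le> (\<Sum>i<N. \<bar>ln (\<phi> (y i)) - ln (\<phi> (x i))\<bar>)"
    by (simp only: sum_subtractf[symmetric]) (rule sum_abs)
  also have "\<dots> \<le> (\<Sum>i<N. 12 * L / \<epsilon> * sqrt \<bar>1 - u\<^sup>2\<bar> * (1 + (y i)\<^sup>2 + (x i)\<^sup>2))"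
  proof (intro sum_mono abs_ln_diff_le_Holder[OF Holder \<open>L \<ge> 0\<close> \<open>\<epsilon> > 0\<close> lower])
    fix i assume "i \<in> {..<N}"
    then have "\<bar>y i - x i\<bar> = \<bar>1 - u\<bar> * \<bar>y i\<bar>" by (simp add: xy abs_mult[symmetric] algebra_simps)
    also have "\<dots> \<le> \<bar>1 - u\<^sup>2\<bar> * \<bar>y i\<bar>" using le by (rule mult_right_mono) simp
    finally show "\<bar>y i - x i\<bar> \<le> \<bar>1 - u\<^sup>2\<bar> * \<bar>y i\<bar>" .
  qed simp
  also have "\<dots> = 12 * L / \<epsilon> * sqrt \<bar>1 - u\<^sup>2\<bar> * (N + (\<Sum>i<N. (y i)\<^sup>2) + (\<Sum>i<N. (x i)\<^sup>2))"
    by (simp only: sum_distrib_left[symmetric] sum.distrib) simp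
  also have "\<dots> = 12 * L / \<epsilon> * (sqrt \<bar>1 - u\<^sup>2\<bar> * (2 + u\<^sup>2)) * N"
  proof -
    have "(\<Sum>i<N. (x i)\<^sup>2) = u\<^sup>2 * N" using N by (simp add: u2 norm_pow_sq)
    then have "N + (\<Sum>i<N. (y i)\<^sup>2) + (\<Sum>i<N. (x i)\<^sup>2) = (2 + u\<^sup>2) * N"
      using sphere_proj_sum_sq[OF x] by (simp add: y_def algebra_simps)
    then show ?thesis by (simp only: mult.assoc)
  qed
  also have "\<dots> \<le> 12 * L / \<epsilon> * (real N powr (- 1 / 4) * (4 * (1 + z\<^sup>2))) * N"
  proof (intro mult_left_mono mult_right_mono)
    define q where "q = real N powr (- 1 / 4)"
    have q: "0 < q" "q \<le> 1" using N by (auto simp: q_def powr_minus_divide ge_one_powr_ge_zero)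
    have d: "\<bar>1 - u\<^sup>2\<bar> = q\<^sup>2 * z"
    proof -
      have "q\<^sup>2 = 1 / sqrt N"
        using N powr_add[of "real N" "-1/4" "-1/4"] powr_minus_divide[of "real N" "1/2"]
        by (simp add: q_def powr_half_sqrt power2_eq_square)
      then show ?thesis using N by (simp add: z_def)
    qed
    have q2: "q\<^sup>2 \<le> 1" using q by (simp add: power_le_one)
    have "2 + u\<^sup>2 \<le> 3 + \<bar>1 - u\<^sup>2\<bar>" by linarith
    also have "\<dots> \<le> 3 + z" using mult_right_mono[OF q2 z] by (simp add: d)
    finally have 1: "2 + u\<^sup>2 \<le> 3 + z" .
    have 2: "sqrt \<bar>1 - u\<^sup>2\<bar> = q * sqrt z" using q by (simp add: d real_sqrt_mult)
    have s1: "sqrt z \<le> 1 + z\<^sup>2" "sqrt z * z \<le> 1 + z\<^sup>2"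
    proof -
      have "sqrt z \<le> 1 \<or> sqrt z \<le> z"
        using z by (cases "z \<le> 1") (auto intro!: real_le_lsqrt simp: power2_eq_square intro: mult_left_mono)
      moreover have "z \<le> 1 + z\<^sup>2" using zero_le_power2[of "z - 1/2"] by (simp add: power2_eq_square algebra_simps)
      ultimately show "sqrt z \<le> 1 + z\<^sup>2" using z by (auto intro: order_trans[of _ 1])
      have "sqrt z * z \<le> z \<or> sqrt z * z \<le> z * z"
        using z \<open>sqrt z \<le> 1 \<or> sqrt z \<le> z\<close> mult_right_mono[of "sqrt z" 1 z] mult_right_mono[of "sqrt z" z z] by auto
      then show "sqrt z * z \<le> 1 + z\<^sup>2" using \<open>z \<le> 1 + z\<^sup>2\<close> by (auto simp: power2_eq_square)
    qed
    have "sqrt \<bar>1 - u\<^sup>2\<bar> * (2 + u\<^sup>2) \<le> q * sqrt z * (3 + z)"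
      unfolding 2 using q z by (intro mult_left_mono 1) auto
    also have "\<dots> = q * (3 * sqrt z + sqrt z * z)" by (simp add: algebra_simps)
    also have "\<dots> \<le> q * (3 * (1 + z\<^sup>2) + (1 + z\<^sup>2))" using s1 q by (intro mult_left_mono add_mono) auto
    finally show "sqrt \<bar>1 - u\<^sup>2\<bar> * (2 + u\<^sup>2) \<le> real N powr (- 1 / 4) * (4 * (1 + z\<^sup>2))" by (simp add: q_def)
  qed (use \<open>L \<ge> 0\<close> \<open>\<epsilon> > 0\<close> in simp_all)
  also have "\<dots> = 48 * L / \<epsilon> * (real N powr (- 1 / 4) * N) * (1 + z\<^sup>2)" by simp
  also have "real N powr (- 1 / 4) * N = real N powr (3 / 4)"
    using N powr_add[of "real N" "-1/4" 1] by simp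
  also have "z\<^sup>2 = real N * (1 - (norm_pow N x)\<^sup>2 / real N)\<^sup>2"
    by (simp add: z_def power_mult_distrib u2)
  finally show ?thesis by (simp add: y_def)
qed

section \<open>Relative entropy\<close>

text \<open>The Radon-Nikodym derivative agrees with \<open>h\<close> almost everywhere, which is
  enough to carry over both the integrability test and the integral in the definition.\<close>

lemma relative_entropy_density:
  assumes "sigma_finite_measure M" and [measurable]: "h \<in> borel_measurable M" and nn: "\<And>x. 0 \<le> h x"
    and int: "integrable M (\<lambda>x. h x * ln (h x))"
  shows "relative_entropy (density M (\<lambda>x. ennreal (h x))) M = ereal (\<integral>x. h x * ln (h x) \<partial>M)"
proof -
  interpret sigma_finite_measure M by fact
  define r where "r = (\<lambda>x. enn2real (RN_deriv M (density M (\<lambda>x. ennreal (h x))) x))"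
  have "AE x in M. ennreal (h x) = RN_deriv M (density M (\<lambda>x. ennreal (h x))) x"
    by (intro RN_deriv_unique) auto
  then have r: "AE x in M. r x = h x"
    by eventually_elim (metis enn2real_ennreal nn r_def)
  have [measurable]: "r \<in> borel_measurable M" unfolding r_def by measurable
  have eq: "AE x in M. r x * ln (r x) = h x * ln (h x)" using r by eventually_elim simp
  have "integrable M (\<lambda>x. r x * ln (r x))"
    using int eq by (subst integrable_cong_AE[of _ _ "\<lambda>x. h x * ln (h x)"]) auto
  moreover have "(\<integral>x. r x * ln (r x) \<partial>M) = (\<integral>x. h x * ln (h x) \<partial>M)"
    using eq by (intro integral_cong_AE) auto
  moreover have "absolutely_continuous M (density M (\<lambda>x. ennreal (h x)))"
    by (rule absolutely_continuousI_density) simp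
  ultimately show ?thesis by (simp add: relative_entropy_def r_def[symmetric] Let_def)
qed

text \<open>Integrate ln b \<le> ln a + (b/a - 1), which is ln t \<le> t - 1 at t = b/a. For
  integrability of ln b this is the upper bound, and the same inequality at 1/b supplies the lower
  one. The law \<mu>^N is later put in for \<open>M\<close>: the upper entropy bound takes for
  \<open>b\<close> the density of the projected law, the lower bound takes it for
  \<open>a\<close>.\<close>

lemma
  fixes a b :: "'a \<Rightarrow> real"
  assumes "prob_space M" and [measurable]: "a \<in> borel_measurable M" "b \<in> borel_measurable M"
    and pos: "AE x in M. 0 < a x" "AE x in M. 0 < b x"
    and le1: "(\<integral>\<^sup>+x. ennreal (b x / a x) \<partial>M) \<le> 1"
    and int: "integrable M (\<lambda>x. ln (a x))"
  shows Gibbs_inequality: "integrable M (\<lambda>x. ln (b x)) \<Longrightarrow> (\<integral>x. ln (b x) \<partial>M) \<le> (\<integral>x. ln (a x) \<partial>M)"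
    and Gibbs_integrable: "(\<integral>\<^sup>+x. ennreal (1 / b x) \<partial>M) \<le> 1 \<Longrightarrow> integrable M (\<lambda>x. ln (b x))"
proof -
  interpret prob_space M by fact
  have nn: "AE x in M. 0 \<le> b x / a x" using pos by eventually_elim simp
  have i: "integrable M (\<lambda>x. b x / a x)"
    using le1 nn by (intro integrableI_nonneg) (auto simp: less_top[symmetric] top_unique)
  have "ennreal (\<integral>x. b x / a x \<partial>M) \<le> 1"
    using le1 nn_integral_eq_integral[OF i nn] by simp
  then have I: "(\<integral>x. b x / a x \<partial>M) \<le> 1" by simp
  have pt: "AE x in M. ln (b x) \<le> ln (a x) + (b x / a x - 1)"
    using pos
  proof eventually_elim
    case (elim x)
    then have "ln (b x) - ln (a x) = ln (b x / a x)" by (simp add: ln_div)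
    also have "\<dots> \<le> b x / a x - 1" using elim by (intro ln_le_minus_one) simp
    finally show ?case by simp
  qed
  show "(\<integral>x. ln (b x) \<partial>M) \<le> (\<integral>x. ln (a x) \<partial>M)" if "integrable M (\<lambda>x. ln (b x))"
  proof -
    have "(\<integral>x. ln (b x) \<partial>M) \<le> (\<integral>x. ln (a x) + (b x / a x - 1) \<partial>M)"
      using that int i pt by (intro integral_mono_AE) auto
    also have "\<dots> = (\<integral>x. ln (a x) \<partial>M) + ((\<integral>x. b x / a x \<partial>M) - 1)"
      using int i by (simp add: prob_space)
    finally show ?thesis using I by simp
  qed
  show "integrable M (\<lambda>x. ln (b x))" if le2: "(\<integral>\<^sup>+x. ennreal (1 / b x) \<partial>M) \<le> 1"
  proof -
    have j: "integrable M (\<lambda>x. 1 / b x)"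
      using le2 pos(2) by (intro integrableI_nonneg) (auto simp: less_top[symmetric] top_unique elim!: eventually_mono)
    show ?thesis
    proof (rule Bochner_Integration.integrable_bound)
      show "integrable M (\<lambda>x. \<bar>ln (a x)\<bar> + b x / a x + 1 / b x)"
        using int i j by (intro Bochner_Integration.integrable_add integrable_abs)
      show "AE x in M. norm (ln (b x)) \<le> norm (\<bar>ln (a x)\<bar> + b x / a x + 1 / b x)"
        using pt pos
      proof eventually_elim
        case (elim x)
        have "- ln (b x) = ln (1 / b x)" using elim by (simp add: ln_div)
        also have "\<dots> \<le> 1 / b x - 1" using elim by (intro ln_le_minus_one) simp
        finally have "- ln (b x) \<le> 1 / b x" by simp
        moreover have "0 \<le> b x / a x" "0 \<le> 1 / b x" using elim by auto
        ultimately show ?case using elim unfolding real_norm_def by linarith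
      qed
    qed simp
  qed
qed

section \<open>Bounded densities with a fourth moment\<close>

text \<open>The Gaussian is an instance as well as the given density, so the concentration of the
  radius and the product formulas are available for both. The Hoelder bound is a separate hypothesis
  of the lemmas that use it.\<close>

locale bounded_density =
  fixes f :: "real \<Rightarrow> real" and M :: real
  assumes meas [measurable]: "f \<in> borel_measurable borel"
    and nonneg: "\<And>x. 0 \<le> f x"
    and total: "(\<integral>\<^sup>+x. ennreal (f x) \<partial>lborel) = 1"
    and moment4: "integrable lborel (\<lambda>x. x ^ 4 * f x)"
    and second_moment: "(\<integral>x. x\<^sup>2 * f x \<partial>lborel) = 1"
    and bounded: "\<And>x. f x \<le> M"
begin

abbreviation "\<mu> \<equiv> density lborel f"
abbreviation "normal \<equiv> density lborel std_normal_density"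

sublocale prob_space \<mu>
  by (rule prob_spaceI) (simp add: emeasure_density total)

lemma prob_UNIV: "prob UNIV = 1"
  using prob_space by simp

lemma integrable_f: "integrable lborel f"
  using total nonneg by (intro integrableI_nonneg) auto

text \<open>A function that is not integrable has integral 0 by convention, so an integral equal to
  1 forces integrability.\<close>

lemma integrable_sq: "integrable lborel (\<lambda>x. x\<^sup>2 * f x)"
  using second_moment not_integrable_integral_eq by fastforce

lemma integrable_mu_iff:
  fixes g :: "real \<Rightarrow> real"
  assumes "g \<in> borel_measurable borel"
  shows "integrable \<mu> g \<longleftrightarrow> integrable lborel (\<lambda>x. f x * g x)"
  using assms nonneg by (subst integrable_density) auto

lemma integral_mu:
  fixes g :: "real \<Rightarrow> real"
  assumes "g \<in> borel_measurable borel"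
  shows "(\<integral>x. g x \<partial>\<mu>) = (\<integral>x. f x * g x \<partial>lborel)"
  using assms nonneg by (subst integral_density) auto

lemma mu_sq: "integrable \<mu> (\<lambda>x. x\<^sup>2)" "(\<integral>x. x\<^sup>2 \<partial>\<mu>) = 1"
  using integrable_sq second_moment by (simp_all add: integrable_mu_iff integral_mu mult.commute)

lemma mu_variance: "integrable \<mu> (\<lambda>x. (x\<^sup>2 - 1)\<^sup>2)"
proof -
  have "integrable \<mu> (\<lambda>x. x ^ 4)" using moment4 by (simp add: integrable_mu_iff mult.commute)
  then have "integrable \<mu> (\<lambda>x. x ^ 4 - 2 * x\<^sup>2 + 1)"
    by (intro Bochner_Integration.integrable_add Bochner_Integration.integrable_diff integrable_mult_right mu_sq(1)) auto
  moreover have "(\<lambda>x::real. x ^ 4 - 2 * x\<^sup>2 + 1) = (\<lambda>x. (x\<^sup>2 - 1)\<^sup>2)"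
    by (auto simp: power2_eq_square power4_eq_xxxx algebra_simps)
  ultimately show ?thesis by simp
qed

text \<open>The positive part of f ln f is controlled by the bound \<open>M\<close>. For the
  negative part \<open>f\<close> is compared with the Gaussian g: f (ln g - ln f) \<le> g - f, and
  -ln g is quadratic, so the second moment suffices.\<close>

lemma integrable_ln: "integrable \<mu> (\<lambda>x. ln (f x))"
proof -
  define c where "c = ln (sqrt (2 * pi))"
  have ln_normal: "ln (std_normal_density x) = - (x\<^sup>2 / 2) - c" for x
    by (simp add: normal_density_def c_def ln_mult ln_div)
  have "integrable lborel (\<lambda>x. f x * ln (f x))"
  proof (rule Bochner_Integration.integrable_bound)
    show "integrable lborel (\<lambda>x. M * f x + x\<^sup>2 * f x + \<bar>c\<bar> * f x + std_normal_density x)"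
      by (intro Bochner_Integration.integrable_add integrable_mult_right integrable_f integrable_sq) simp
    show "AE x in lborel. norm (f x * ln (f x)) \<le> norm (M * f x + x\<^sup>2 * f x + \<bar>c\<bar> * f x + std_normal_density x)"
    proof (rule AE_I2)
      fix x
      let ?g = "std_normal_density x"
      have g: "?g > 0" by (simp add: normal_density_pos)
      have M: "M \<ge> 0" using nonneg[of x] bounded[of x] by simp
      have nn: "0 \<le> M * f x" "0 \<le> x\<^sup>2 * f x" "0 \<le> \<bar>c\<bar> * f x"
        using M nonneg[of x] by auto
      show "norm (f x * ln (f x)) \<le> norm (M * f x + x\<^sup>2 * f x + \<bar>c\<bar> * f x + ?g)"
      proof (cases "f x = 0")
        case False
        then have f: "f x > 0" using nonneg[of x] by simp
        have "f x * ln (f x) \<le> f x * (f x - 1)" using f ln_le_minus_one[of "f x"] by simp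
        also have "\<dots> \<le> f x * M" using f bounded[of x] by (intro mult_left_mono) auto
        finally have 1: "f x * ln (f x) \<le> M * f x" by (simp add: mult.commute)
        have "ln ?g - ln (f x) = ln (?g / f x)" using f g by (simp add: ln_div)
        also have "\<dots> \<le> ?g / f x - 1" using f g by (intro ln_le_minus_one) simp
        finally have "f x * (ln ?g - ln (f x)) \<le> f x * (?g / f x - 1)" using f by simp
        also have "\<dots> = ?g - f x" using f by (simp add: field_simps)
        finally have "- (f x * ln (f x)) \<le> f x * (x\<^sup>2 / 2 + c) + ?g - f x"
          by (simp add: ln_normal algebra_simps)
        also have "\<dots> \<le> x\<^sup>2 * f x + \<bar>c\<bar> * f x + ?g"
        proof -
          have "x\<^sup>2 / 2 + c \<le> x\<^sup>2 + \<bar>c\<bar>" using zero_le_power2[of x] by linarith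
          then have "f x * (x\<^sup>2 / 2 + c) \<le> f x * (x\<^sup>2 + \<bar>c\<bar>)" using f by (intro mult_left_mono) auto
          then show ?thesis using f by (simp add: algebra_simps)
        qed
        finally show ?thesis using 1 nn g unfolding real_norm_def by linarith
      qed (use g nn in simp)
    qed
  qed simp
  then show ?thesis by (simp add: integrable_mu_iff)
qed

text \<open>A real number to stand for H(f | \<gamma>): since the second moment is 1, the mean of
  -ln \<gamma> is the constant (ln (2 \<pi>) + 1) / 2.\<close>

definition normal_entropy :: real where
  "normal_entropy = (\<integral>x. ln (f x) \<partial>\<mu>) + (ln (2 * pi) + 1) / 2"

lemma relative_entropy_mu: "relative_entropy \<mu> normal = ereal normal_entropy"
proof -
  let ?g = std_normal_density
  have g: "?g x > 0" for x :: real by (simp add: normal_density_pos)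
  define h where "h x = f x / ?g x" for x
  have [measurable]: "h \<in> borel_measurable borel" unfolding h_def by measurable
  have h_nn: "0 \<le> h x" for x using nonneg[of x] g[of x] by (simp add: h_def)
  have dens: "density normal (\<lambda>x. ennreal (h x)) = \<mu>"
  proof -
    have "ennreal (?g x) * ennreal (h x) = ennreal (f x)" for x
      using g[of x] h_nn[of x] by (simp add: h_def ennreal_mult[symmetric] less_imp_neq[THEN not_sym])
    then show ?thesis by (subst density_density_eq) simp_all
  qed
  have eq: "?g x * (h x * ln (h x)) = f x * (ln (f x) + (x\<^sup>2 + ln (2 * pi)) / 2)" for x
  proof (cases "f x = 0")
    case False
    then have "f x > 0" using nonneg[of x] by simp
    then have "ln (h x) = ln (f x) + (x\<^sup>2 + ln (2 * pi)) / 2"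
      by (simp add: h_def ln_div g normal_density_def ln_mult ln_sqrt add_divide_distrib)
    moreover have "?g x * h x = f x" using g[of x] by (simp add: h_def)
    ultimately show ?thesis by (metis mult.assoc)
  qed (simp add: h_def)
  have int: "integrable \<mu> (\<lambda>x. ln (f x) + (x\<^sup>2 + ln (2 * pi)) / 2)"
    using integrable_ln mu_sq by simp
  have "integrable normal (\<lambda>x. h x * ln (h x))"
    using int by (subst integrable_density) (auto simp: eq integrable_mu_iff)
  from relative_entropy_density[OF _ _ h_nn this]
  have "relative_entropy \<mu> normal = ereal (\<integral>x. h x * ln (h x) \<partial>normal)"
    using prob_space_std_normal by (simp add: dens prob_space_imp_sigma_finite)
  also have "(\<integral>x. h x * ln (h x) \<partial>normal) = (\<integral>x. ln (f x) + (x\<^sup>2 + ln (2 * pi)) / 2 \<partial>\<mu>)"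
    by (subst integral_density) (auto simp: eq integral_mu)
  also have "\<dots> = normal_entropy"
    using integrable_ln mu_sq prob_UNIV by (simp add: normal_entropy_def add_divide_distrib)
  finally show ?thesis .
qed

end

lemma bounded_density_normal: "bounded_density std_normal_density 1"
proof
  show "(\<integral>\<^sup>+x. ennreal (std_normal_density x) \<partial>lborel) = 1"
    by (simp add: nn_integral_eq_integral integrable_normal_density integral_normal_density)
  show "integrable lborel (\<lambda>x::real. x ^ 4 * std_normal_density x)"
    using has_bochner_integral_integrable[of lborel] std_normal_moment_even[of 2]
    by (simp add: has_bochner_integral_iff mult.commute)
  show "(\<integral>x. x\<^sup>2 * std_normal_density x \<partial>lborel) = 1"
    using integral_std_normal_moment_even[of 1] by (simp add: mult.commute)
  show "std_normal_density x \<le> 1" for x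
  proof -
    have "1 / sqrt (2 * pi) \<le> 1" using pi_gt3 by simp
    moreover have "exp (- x\<^sup>2 / 2) \<le> 1" by simp
    ultimately have "1 / sqrt (2 * pi) * exp (- x\<^sup>2 / 2) \<le> 1 * 1" by (intro mult_mono) auto
    then show ?thesis by (simp add: normal_density_def)
  qed
qed auto

text \<open>The fourth Gaussian moment is 3, hence 3 - 2 + 1. The explicit value is what lets a
  fixed shell around the sphere be given probability at least 1/2.\<close>

lemma normal_variance: "(\<integral>x. (x\<^sup>2 - 1)\<^sup>2 \<partial>density lborel std_normal_density) = 2"
proof -
  interpret bounded_density std_normal_density 1 by (rule bounded_density_normal)
  have 4: "has_bochner_integral normal (\<lambda>x. x ^ 4) 3"
    using std_normal_moment_even[of 2]
    by (simp add: has_bochner_integral_iff integrable_mu_iff integral_mu fact_numeral)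
  have "(\<integral>x. (x\<^sup>2 - 1)\<^sup>2 \<partial>normal) = (\<integral>x. x ^ 4 - 2 * x\<^sup>2 + 1 \<partial>normal)"
    by (intro Bochner_Integration.integral_cong) (auto simp: power2_eq_square power4_eq_xxxx algebra_simps)
  also have "\<dots> = 3 - 2 * 1 + 1"
    using 4 mu_sq prob_UNIV by (simp add: has_bochner_integral_iff)
  finally show ?thesis by simp
qed

section \<open>The projected law and the upper entropy bound\<close>

context bounded_density
begin

lemma measure_pow_mu:
  "measure_pow \<mu> N = density (measure_pow lborel N) (\<lambda>x. ennreal (\<Prod>i<N. f (x i)))"
  by (rule measure_pow_density) (auto intro: nonneg prob_space_axioms)

lemma nn_integral_measure_pow_mu:
  assumes "\<phi> \<in> borel_measurable (borel_pow N)"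
  shows "(\<integral>\<^sup>+x. \<phi> x \<partial>measure_pow \<mu> N) = (\<integral>\<^sup>+x. ennreal (\<Prod>i<N. f (x i)) * \<phi> x \<partial>measure_pow lborel N)"
  unfolding measure_pow_mu using assms by (intro nn_integral_density) measurable

lemma AE_measure_pow_mu:
  "AE x in measure_pow lborel N. P x \<Longrightarrow> AE x in measure_pow \<mu> N. P x"
  unfolding measure_pow_mu by (subst AE_density) (measurable, auto)

text \<open>The density may have zeros, but its product measure does not charge them; logarithms of
  products can therefore be split almost everywhere.\<close>

lemma AE_measure_pow_pos: "AE x in measure_pow \<mu> N. \<forall>i<N. 0 < f (x i)"
proof -
  have pos: "0 < ennreal (\<Prod>i<N. f (x i)) \<longrightarrow> (\<forall>i<N. 0 < f (x i))" for x
    using nonneg by (auto simp: less_le prod_nonneg)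
  show ?thesis unfolding measure_pow_mu by (subst AE_density) (measurable, use pos in auto)
qed

lemma AE_norm_pow_nonzero: "N \<ge> 1 \<Longrightarrow> AE x in measure_pow \<mu> N. norm_pow N x \<noteq> 0"
  by (intro AE_measure_pow_mu AE_lborel_norm_pow_nonzero)

text \<open>The quantity is the square of the sum of the centred variables x_i^2 - 1, divided by N.
  By independence its mean is the variance of one x_i^2, for every N; this is the form in which the
  law of large numbers for the radius is used.\<close>

lemma norm_pow_deviation:
  assumes "N \<ge> 1"
  shows "has_bochner_integral (measure_pow \<mu> N) (\<lambda>x. real N * (1 - (norm_pow N x)\<^sup>2 / real N)\<^sup>2)
    (\<integral>x. (x\<^sup>2 - 1)\<^sup>2 \<partial>\<mu>)"
proof -
  have "has_bochner_integral (measure_pow \<mu> N) (\<lambda>x. (\<Sum>i<N. (x i)\<^sup>2 - 1)\<^sup>2) (real N * (\<integral>x. (x\<^sup>2 - 1)\<^sup>2 \<partial>\<mu>))"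
    using mu_sq mu_variance prob_UNIV
    by (intro sum_square_measure_pow prob_space_axioms) auto
  then have "has_bochner_integral (measure_pow \<mu> N) (\<lambda>x. 1 / real N * (\<Sum>i<N. (x i)\<^sup>2 - 1)\<^sup>2)
      (1 / real N * (real N * (\<integral>x. (x\<^sup>2 - 1)\<^sup>2 \<partial>\<mu>)))"
    by (intro has_bochner_integral_mult_right) auto
  moreover have "1 / real N * (\<Sum>i<N. (x i)\<^sup>2 - 1)\<^sup>2 = real N * (1 - (norm_pow N x)\<^sup>2 / real N)\<^sup>2" for x
  proof -
    have "(\<Sum>i<N. (x i)\<^sup>2 - 1) = - real N * (1 - (norm_pow N x)\<^sup>2 / real N)"
      using assms by (simp add: sum_subtractf norm_pow_sq field_simps)
    then show ?thesis using assms by (simp add: power_mult_distrib power2_eq_square[of "real N"])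
  qed
  ultimately show ?thesis using assms by simp
qed

lemma sets_projected_pow [measurable_cong, simp]: "sets (projected_pow \<mu> N) = sets (borel_pow N)"
  by (simp add: projected_pow_def)

lemma prob_space_projected_pow: "prob_space (projected_pow \<mu> N)"
proof -
  interpret P: prob_space "measure_pow \<mu> N" by (intro prob_space_measure_pow prob_space_axioms)
  show ?thesis unfolding projected_pow_def by (rule P.prob_space_distr) measurable
qed

text \<open>The Gaussian density is positive everywhere, so a null set of the sphere pulls back
  under the projection to a Lebesgue null set, and this is null for every product law with a
  density.\<close>

lemma absolutely_continuous_projected_pow:
  assumes "N \<ge> 1"
  shows "absolutely_continuous (sphere_uniform N) (projected_pow \<mu> N)"
  unfolding absolutely_continuous_def
proof
  fix A assume "A \<in> null_sets (sphere_uniform N)"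
  then have [measurable]: "A \<in> sets (borel_pow N)" and A: "emeasure (sphere_uniform N) A = 0"
    by auto
  let ?w = "\<lambda>x. ennreal (\<Prod>i<N. std_normal_density (x i))"
  have "(\<integral>\<^sup>+x. indicator A (sphere_proj N x) \<partial>measure_pow normal N) = 0"
    using nn_integral_sphere_proj_normal[OF assms, of "indicator A"] A by simp
  then have "(\<integral>\<^sup>+x. ?w x * indicator A (sphere_proj N x) \<partial>measure_pow lborel N) = 0"
    by (subst (asm) bounded_density.nn_integral_measure_pow_mu[OF bounded_density_normal]) measurable
  then have "AE x in measure_pow lborel N. ?w x * indicator A (sphere_proj N x) = 0"
    by (subst (asm) nn_integral_0_iff_AE) measurable
  then have "AE x in measure_pow lborel N. sphere_proj N x \<notin> A"
  proof eventually_elim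
    case (elim x)
    have "0 < (\<Prod>i<N. std_normal_density (x i))" by (intro prod_pos) (simp add: normal_density_pos)
    then have "?w x \<noteq> 0" by (simp only: ennreal_eq_0_iff not_le)
    with elim show ?case by (simp only: mult_eq_0_iff indicator_eq_0_iff) simp
  qed
  then have "AE x in measure_pow \<mu> N. sphere_proj N x \<notin> A" by (rule AE_measure_pow_mu)
  then have "AE y in projected_pow \<mu> N. y \<notin> A"
    unfolding projected_pow_def by (subst AE_distr_iff) measurable
  then show "A \<in> null_sets (projected_pow \<mu> N)"
    by (subst AE_iff_null_sets) simp_all
qed

lemma projected_pow_density:
  assumes "N \<ge> 1"
  obtains k :: "(nat \<Rightarrow> real) \<Rightarrow> real" where
    "k \<in> borel_measurable (borel_pow N)" "\<And>y. 0 \<le> k y"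
    "density (sphere_uniform N) (\<lambda>y. ennreal (k y)) = projected_pow \<mu> N"
    "AE x in measure_pow \<mu> N. 0 < k (sphere_proj N x)"
proof -
  interpret S: prob_space "sphere_uniform N" by (rule prob_space_sphere_uniform) fact
  interpret F: prob_space "projected_pow \<mu> N" by (rule prob_space_projected_pow)
  have ac: "absolutely_continuous (sphere_uniform N) (projected_pow \<mu> N)"
    by (rule absolutely_continuous_projected_pow) fact
  obtain k where k: "k \<in> borel_measurable (sphere_uniform N)"
      "AE y in sphere_uniform N. RN_deriv (sphere_uniform N) (projected_pow \<mu> N) y = ennreal (k y)"
      "AE y in projected_pow \<mu> N. 0 < k y" "\<And>y. 0 \<le> k y"
    using S.real_RN_deriv[OF F.finite_measure_axioms ac] by auto
  have m[measurable]: "k \<in> borel_measurable (borel_pow N)" using k(1) by simp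
  have "density (sphere_uniform N) (\<lambda>y. ennreal (k y)) =
      density (sphere_uniform N) (RN_deriv (sphere_uniform N) (projected_pow \<mu> N))"
    using k(2) by (intro density_cong) (auto elim!: eventually_mono)
  also have "\<dots> = projected_pow \<mu> N"
    by (rule S.density_RN_deriv[OF ac]) simp
  finally have "density (sphere_uniform N) (\<lambda>y. ennreal (k y)) = projected_pow \<mu> N" .
  moreover have "AE x in measure_pow \<mu> N. 0 < k (sphere_proj N x)"
    using k(3) unfolding projected_pow_def by (subst (asm) AE_distr_iff) measurable
  ultimately show thesis using that[of k] m k(4) by blast
qed

lemma nn_integral_projected_density:
  assumes "N \<ge> 1" and [measurable]: "k \<in> borel_measurable (borel_pow N)" "\<phi> \<in> borel_measurable (borel_pow N)"
    and dens: "density (sphere_uniform N) (\<lambda>y. ennreal (k y)) = projected_pow \<mu> N"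
  shows "(\<integral>\<^sup>+x. \<phi> (sphere_proj N x) \<partial>measure_pow \<mu> N) = (\<integral>\<^sup>+y. ennreal (k y) * \<phi> y \<partial>sphere_uniform N)"
proof -
  have "(\<integral>\<^sup>+x. \<phi> (sphere_proj N x) \<partial>measure_pow \<mu> N) = (\<integral>\<^sup>+y. \<phi> y \<partial>projected_pow \<mu> N)"
    unfolding projected_pow_def by (subst nn_integral_distr) measurable
  also have "\<dots> = (\<integral>\<^sup>+y. ennreal (k y) * \<phi> y \<partial>sphere_uniform N)"
    unfolding dens[symmetric] by (subst nn_integral_density) measurable
  finally show ?thesis .
qed

lemma
  shows integrable_sum_ln: "integrable (measure_pow \<mu> N) (\<lambda>x. \<Sum>i<N. ln (f (x i)))"
    and integral_sum_ln: "(\<integral>x. (\<Sum>i<N. ln (f (x i))) \<partial>measure_pow \<mu> N) = real N * (\<integral>x. ln (f x) \<partial>\<mu>)"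
proof -
  have i: "integrable (measure_pow \<mu> N) (\<lambda>x. ln (f (x i)))" if "i < N" for i
    using integrable_measure_pow_component[OF prob_space_axioms _ that, of "\<lambda>t. ln (f t)"] integrable_ln by simp
  show "integrable (measure_pow \<mu> N) (\<lambda>x. \<Sum>i<N. ln (f (x i)))"
    using i by (intro Bochner_Integration.integrable_sum) auto
  show "(\<integral>x. (\<Sum>i<N. ln (f (x i))) \<partial>measure_pow \<mu> N) = real N * (\<integral>x. ln (f x) \<partial>\<mu>)"
    using i integral_measure_pow_component[OF prob_space_axioms, of _ N "\<lambda>t. ln (f t)"] by simp
qed

lemma
  shows integrable_norm_sq: "integrable (measure_pow \<mu> N) (\<lambda>x. (norm_pow N x)\<^sup>2)"
    and integral_norm_sq: "(\<integral>x. (norm_pow N x)\<^sup>2 \<partial>measure_pow \<mu> N) = real N"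
proof -
  have i: "integrable (measure_pow \<mu> N) (\<lambda>x. (x i)\<^sup>2)" if "i < N" for i
    using integrable_measure_pow_component[OF prob_space_axioms _ that, of "\<lambda>t. t\<^sup>2"] mu_sq by simp
  show "integrable (measure_pow \<mu> N) (\<lambda>x. (norm_pow N x)\<^sup>2)"
    unfolding norm_pow_sq using i by (intro Bochner_Integration.integrable_sum) auto
  show "(\<integral>x. (norm_pow N x)\<^sup>2 \<partial>measure_pow \<mu> N) = real N"
    using i integral_measure_pow_component[OF prob_space_axioms, of _ N "\<lambda>t. t\<^sup>2"] mu_sq
    by (simp add: norm_pow_sq)
qed

text \<open>Data processing through the Gibbs inequality, with \<open>a\<close> the density of the
  product law relative to the Gaussian power and \<open>b\<close> the density on the sphere composed
  with the projection. The mean of b/a is at most the Gaussian mean of \<open>b\<close>, which is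
  the total mass of the projected law. The mean of 1/b is at most 1 too, whence ln b is integrable
  and the entropy on the sphere takes its finite branch.\<close>

lemma projected_entropy:
  assumes "N \<ge> 1" and k: "k \<in> borel_measurable (borel_pow N)" "\<And>y. 0 \<le> k y"
    "density (sphere_uniform N) (\<lambda>y. ennreal (k y)) = projected_pow \<mu> N"
    and k_pos: "AE x in measure_pow \<mu> N. 0 < k (sphere_proj N x)"
  shows "integrable (measure_pow \<mu> N) (\<lambda>x. ln (k (sphere_proj N x)))" (is ?int)
    and "(\<integral>x. ln (k (sphere_proj N x)) \<partial>measure_pow \<mu> N) \<le> real N * normal_entropy" (is ?le)
    and "relative_entropy (projected_pow \<mu> N) (sphere_uniform N)
      = ereal (\<integral>x. ln (k (sphere_proj N x)) \<partial>measure_pow \<mu> N)" (is ?eq)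
proof -
  interpret S: prob_space "sphere_uniform N" by (rule prob_space_sphere_uniform) fact
  note k(1)[measurable]
  let ?P = "measure_pow \<mu> N"
  define w where "w x = (\<Prod>i<N. std_normal_density (x i))" for x :: "nat \<Rightarrow> real"
  have w_pos: "w x > 0" for x unfolding w_def by (intro prod_pos) (simp add: normal_density_pos)
  have [measurable]: "w \<in> borel_measurable (borel_pow N)" unfolding w_def by measurable
  define a where "a x = (\<Prod>i<N. f (x i)) / w x" for x
  define b where "b x = k (sphere_proj N x)" for x
  have [measurable]: "a \<in> borel_measurable (borel_pow N)" "b \<in> borel_measurable (borel_pow N)"
    unfolding a_def b_def by measurable
  have prod_nn: "0 \<le> (\<Prod>i<N. f (x i))" for x by (intro prod_nonneg) (simp add: nonneg)
  have a_pos: "AE x in ?P. 0 < a x"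
    using AE_measure_pow_pos by eventually_elim (auto simp: a_def w_pos intro!: divide_pos_pos prod_pos)
  have b_pos: "AE x in ?P. 0 < b x" using k_pos by (simp add: b_def)
  have ln_a: "AE x in ?P. ln (a x) = (\<Sum>i<N. ln (f (x i))) + (norm_pow N x)\<^sup>2 / 2 + real N * ln (2 * pi) / 2"
    using AE_measure_pow_pos
  proof eventually_elim
    case (elim x)
    then have "ln (\<Prod>i<N. f (x i)) = (\<Sum>i<N. ln (f (x i)))" by (intro ln_prod) auto
    moreover have "0 < (\<Prod>i<N. f (x i))" using elim by (intro prod_pos) auto
    ultimately have "ln (a x) = (\<Sum>i<N. ln (f (x i))) - ln (w x)" 
      by (simp only: a_def ln_divide_pos[OF _ w_pos])
    moreover have "ln (w x) = - (real N * ln (2 * pi) / 2) - (norm_pow N x)\<^sup>2 / 2"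
      by (simp add: w_def prod_std_normal_density ln_mult ln_realpow ln_div ln_sqrt)
    ultimately show ?case by simp
  qed
  have int_rhs: "integrable ?P (\<lambda>x. (\<Sum>i<N. ln (f (x i))) + (norm_pow N x)\<^sup>2 / 2 + real N * ln (2 * pi) / 2)"
  proof -
    interpret P: prob_space ?P by (intro prob_space_measure_pow prob_space_axioms)
    show ?thesis using integrable_sum_ln integrable_norm_sq by simp
  qed
  have int_a: "integrable ?P (\<lambda>x. ln (a x))"
    using int_rhs ln_a by (subst integrable_cong_AE[OF _ _ ln_a]) measurable
  have "(\<integral>x. ln (a x) \<partial>?P) = (\<integral>x. (\<Sum>i<N. ln (f (x i))) + (norm_pow N x)\<^sup>2 / 2 + real N * ln (2 * pi) / 2 \<partial>?P)"
    using ln_a by (intro integral_cong_AE) measurable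
  also have "\<dots> = real N * normal_entropy"
  proof -
    interpret P: prob_space ?P by (intro prob_space_measure_pow prob_space_axioms)
    have "(\<integral>x. (\<Sum>i<N. ln (f (x i))) + (norm_pow N x)\<^sup>2 / 2 + real N * ln (2 * pi) / 2 \<partial>?P)
       = real N * (\<integral>x. ln (f x) \<partial>\<mu>) + real N / 2 + real N * ln (2 * pi) / 2"
      using integrable_sum_ln integrable_norm_sq P.prob_space
      by (simp add: integral_sum_ln integral_norm_sq)
    then show ?thesis by (simp add: normal_entropy_def algebra_simps add_divide_distrib)
  qed
  finally have E_a: "(\<integral>x. ln (a x) \<partial>?P) = real N * normal_entropy" .
  have "(\<integral>\<^sup>+x. ennreal (b x / a x) \<partial>?P) = (\<integral>\<^sup>+x. ennreal (\<Prod>i<N. f (x i)) * ennreal (b x / a x) \<partial>measure_pow lborel N)"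
    by (intro nn_integral_measure_pow_mu) measurable
  also have "\<dots> \<le> (\<integral>\<^sup>+x. ennreal (w x) * ennreal (b x) \<partial>measure_pow lborel N)"
  proof (intro nn_integral_mono)
    fix x
    have b: "0 \<le> b x" using k(2) by (simp add: b_def)
    \<comment> \<open>Equality off the zeros of the product; at a zero the left side is 0, so only
      an inequality holds.\<close>
    have "(\<Prod>i<N. f (x i)) * (b x / a x) \<le> w x * b x"
      using w_pos[of x] b by (cases "(\<Prod>i<N. f (x i)) = 0") (simp_all add: a_def)
    then show "ennreal (\<Prod>i<N. f (x i)) * ennreal (b x / a x) \<le> ennreal (w x) * ennreal (b x)"
      using prod_nn w_pos b by (subst (1 2) ennreal_mult[symmetric]) (auto simp: a_def less_imp_le intro!: divide_nonneg_nonneg ennreal_leI)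
  qed
  also have "\<dots> = (\<integral>\<^sup>+x. ennreal (b x) \<partial>measure_pow normal N)"
    unfolding w_def by (rule bounded_density.nn_integral_measure_pow_mu[OF bounded_density_normal, symmetric]) measurable
  also have "\<dots> = (\<integral>\<^sup>+y. ennreal (k y) \<partial>sphere_uniform N)"
    unfolding b_def by (rule nn_integral_sphere_proj_normal[OF assms(1)]) measurable
  also have "\<dots> = (\<integral>\<^sup>+y. 1 \<partial>projected_pow \<mu> N)"
    unfolding k(3)[symmetric] by (subst nn_integral_density) simp_all
  also have "\<dots> = 1" using prob_space.emeasure_space_1[OF prob_space_projected_pow] by simp
  finally have ba: "(\<integral>\<^sup>+x. ennreal (b x / a x) \<partial>?P) \<le> 1" .
  have "(\<integral>\<^sup>+x. ennreal (1 / b x) \<partial>?P) = (\<integral>\<^sup>+y. ennreal (k y) * ennreal (1 / k y) \<partial>sphere_uniform N)"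
    unfolding b_def by (rule nn_integral_projected_density[OF assms(1) k(1) _ k(3)]) measurable
  also have "\<dots> \<le> (\<integral>\<^sup>+y. 1 \<partial>sphere_uniform N)"
    \<comment> \<open>Where \<open>k\<close> vanishes the quotient 1/k is 0 by convention, and the
      product is 0 instead of 1.\<close>
    using k(2) by (intro nn_integral_mono) (subst ennreal_mult[symmetric], auto)
  also have "\<dots> = 1" by (simp add: S.emeasure_space_1)
  finally have b1: "(\<integral>\<^sup>+x. ennreal (1 / b x) \<partial>?P) \<le> 1" .
  have int_b: "integrable ?P (\<lambda>x. ln (b x))"
    by (rule Gibbs_integrable[OF prob_space_measure_pow[OF prob_space_axioms] _ _ a_pos b_pos ba int_a b1]) measurable
  have "(\<integral>x. ln (b x) \<partial>?P) \<le> (\<integral>x. ln (a x) \<partial>?P)"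
    by (rule Gibbs_inequality[OF prob_space_measure_pow[OF prob_space_axioms] _ _ a_pos b_pos ba int_a int_b]) measurable
  then show ?le by (simp add: E_a b_def)
  show ?int using int_b by (simp add: b_def)
  have int_proj: "integrable (projected_pow \<mu> N) (\<lambda>y. ln (k y))"
    using int_b unfolding projected_pow_def b_def by (subst integrable_distr_eq) measurable
  then have int_kk: "integrable (sphere_uniform N) (\<lambda>y. k y * ln (k y))"
    using k(2) unfolding k(3)[symmetric] by (subst (asm) integrable_density) auto
  have "relative_entropy (projected_pow \<mu> N) (sphere_uniform N) = ereal (\<integral>y. k y * ln (k y) \<partial>sphere_uniform N)"
    using relative_entropy_density[OF S.sigma_finite_measure_axioms _ k(2) int_kk] by (simp add: k(3))
  also have "(\<integral>y. k y * ln (k y) \<partial>sphere_uniform N) = (\<integral>y. ln (k y) \<partial>projected_pow \<mu> N)"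
    using k(2) unfolding k(3)[symmetric] by (subst integral_density) auto
  also have "\<dots> = (\<integral>x. ln (k (sphere_proj N x)) \<partial>?P)"
    unfolding projected_pow_def by (subst integral_distr) measurable
  finally show ?eq .
qed

end

section \<open>The test function on the sphere\<close>

text \<open>Keeps what the exponential integral on the sphere requires of the mixture: mass at most
  1, the Hoelder bound and the lower bound by the heavy tail. The relation to \<open>f\<close> is
  added later.\<close>

locale test_density =
  fixes \<phi> :: "real \<Rightarrow> real" and L \<epsilon> :: real
  assumes meas_test [measurable]: "\<phi> \<in> borel_measurable borel"
    and test_total: "(\<integral>\<^sup>+x. ennreal (\<phi> x) \<partial>lborel) \<le> 1"
    and Holder: "\<And>a b. \<bar>\<phi> a - \<phi> b\<bar> \<le> L * sqrt \<bar>a - b\<bar>"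
    and L_nonneg: "0 \<le> L"
    and \<epsilon>_pos: "0 < \<epsilon>"
    and lower: "\<And>x. \<epsilon> * tail_density x \<le> \<phi> x"
begin

lemma test_pos: "0 < \<phi> x"
  using lower[of x] \<epsilon>_pos tail_density_pos[of x] by (meson less_le_trans mult_pos_pos)

definition err :: "nat \<Rightarrow> real" where
  "err N = 48 * L / \<epsilon> * real N powr (3 / 4)"

lemma err_nonneg: "0 \<le> err N"
  using L_nonneg \<epsilon>_pos by (simp add: err_def)

lemma sum_ln_diff:
  assumes "N \<ge> 1" "norm_pow N x \<noteq> 0"
  shows "\<bar>(\<Sum>i<N. ln (\<phi> (sphere_proj N x i))) - (\<Sum>i<N. ln (\<phi> (x i)))\<bar>
    \<le> err N * (1 + real N * (1 - (norm_pow N x)\<^sup>2 / real N)\<^sup>2)"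
  unfolding err_def using sum_ln_sphere_proj_diff_le[OF Holder L_nonneg \<epsilon>_pos lower assms] by simp

text \<open>On the sphere \<open>sphere_test\<close> is the product of the quotients of \<open>\<phi>\<close> by the normal density, which
  is constant on the sphere when multiplied over the coordinates.\<close>

definition sphere_test :: "nat \<Rightarrow> (nat \<Rightarrow> real) \<Rightarrow> real" where
  "sphere_test N y = exp ((\<Sum>i<N. ln (\<phi> (y i))) + real N * (ln (2 * pi) + 1) / 2)"

lemma measurable_sphere_test [measurable]: "sphere_test N \<in> borel_measurable (borel_pow N)"
  unfolding sphere_test_def by measurable

text \<open>Under the normal distribution the radius is independent of the direction, so it may be
  restricted to a shell of probability at least \<open>1/2\<close> around \<open>sqrt N\<close>. There the projected point can be
  replaced by the point itself, and the Gaussian weight cancels.\<close>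

lemma nn_integral_sphere_test_le:
  assumes N: "N \<ge> 1"
  shows "(\<integral>\<^sup>+y. ennreal (sphere_test N y) \<partial>sphere_uniform N)
    \<le> ennreal (2 * exp (5 * err N + real N powr (3 / 4)))"
proof -
  interpret g: bounded_density std_normal_density 1 by (rule bounded_density_normal)
  let ?G = "measure_pow g.normal N"
  interpret G: prob_space ?G by (intro prob_space_measure_pow prob_space_std_normal)
  define dev where "dev r = real N * (1 - r\<^sup>2 / real N)\<^sup>2" for r
  have [measurable]: "dev \<in> borel_measurable borel" unfolding dev_def by measurable
  \<comment> \<open>The threshold 4 is twice the Gaussian mean 2 of the deviation, so by Markov's
    inequality the shell has probability at least 1/2. The estimate 1 - dev/4 \<le> indicator
    integrates to just this.\<close>
  define A where "A = {r. dev r \<le> 4}"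
  have [measurable]: "A \<in> sets borel" unfolding A_def by measurable
  \<comment> \<open>On the shell the factor 1 + z^2 of the projection error is at most 5. The other
    term bounds the change of the Gaussian weight between the point and the sphere, which is at most
    sqrt N \<le> N^(3/4) in the exponent.\<close>
  define e where "e = 5 * err N + real N powr (3 / 4)"
  define I where "I = (\<integral>\<^sup>+y. ennreal (sphere_test N y) \<partial>sphere_uniform N)"
  have dev_int: "has_bochner_integral ?G (\<lambda>x. dev (norm_pow N x)) 2"
    using g.norm_pow_deviation[OF N] by (simp add: dev_def normal_variance)
  have "1 / 2 = (\<integral>x. 1 - dev (norm_pow N x) / 4 \<partial>?G)"
    using dev_int G.prob_space by (simp add: has_bochner_integral_iff)
  also have "\<dots> \<le> (\<integral>x. indicator A (norm_pow N x) \<partial>?G)"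
  proof (rule integral_mono)
    show "integrable ?G (\<lambda>x. 1 - dev (norm_pow N x) / 4)"
      using dev_int by (simp add: has_bochner_integral_iff)
    show "integrable ?G (\<lambda>x. indicator A (norm_pow N x) :: real)"
      by (rule G.integrable_const_bound[where B = 1]) (auto simp: indicator_def)
    show "1 - dev (norm_pow N x) / 4 \<le> indicator A (norm_pow N x)" for x
      by (auto simp: A_def indicator_def) (simp add: dev_def)
  qed
  finally have "ennreal (1 / 2) \<le> ennreal (\<integral>x. indicator A (norm_pow N x) \<partial>?G)" by (rule ennreal_leI)
  also have "\<dots> = (\<integral>\<^sup>+x. ennreal (indicator A (norm_pow N x)) \<partial>?G)"
    by (intro nn_integral_eq_integral[symmetric] G.integrable_const_bound[where B = 1]) (auto simp: indicator_def)
  also have "\<dots> = (\<integral>\<^sup>+x. indicator A (norm_pow N x) \<partial>?G)"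
    by (intro nn_integral_cong) (simp add: indicator_def)
  finally have half: "ennreal (1 / 2) \<le> (\<integral>\<^sup>+x. indicator A (norm_pow N x) \<partial>?G)" .
  have pt: "(\<Prod>i<N. std_normal_density (x i)) * sphere_test N (sphere_proj N x) \<le> exp e * (\<Prod>i<N. \<phi> (x i))"
    if x: "norm_pow N x \<noteq> 0" and A: "norm_pow N x \<in> A" for x
  proof -
    define D where "D = 1 - (norm_pow N x)\<^sup>2 / real N"
    have D: "real N * D\<^sup>2 \<le> 4" using A by (simp add: A_def dev_def D_def)
    have "(\<Prod>i<N. std_normal_density (x i)) = exp (- (real N * ln (2 * pi) / 2) - (norm_pow N x)\<^sup>2 / 2)"
    proof -
      have "ln (2 * pi) / 2 = ln (sqrt (2 * pi))" by (rule ln_sqrt[symmetric]) simp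
      then have "exp (- (ln (2 * pi) / 2)) = inverse (exp (ln (sqrt (2 * pi))))" by (simp only: exp_minus)
      also have "exp (ln (sqrt (2 * pi))) = sqrt (2 * pi)" by (rule exp_ln) simp
      finally have "1 / sqrt (2 * pi) = exp (- (ln (2 * pi) / 2))" by (simp only: inverse_eq_divide)
      then have "(1 / sqrt (2 * pi)) ^ N = exp (real N * (- (ln (2 * pi) / 2)))"
        by (simp only: exp_of_nat_mult)
      then show ?thesis by (simp add: prod_std_normal_density exp_add[symmetric])
    qed
    \<comment> \<open>The constant in \<open>sphere_test\<close> is the reciprocal of the Gaussian
      weight at radius sqrt N, so what is left of the two weights is exp ((N - |x|^2) / 2).\<close>
    then have "(\<Prod>i<N. std_normal_density (x i)) * sphere_test N (sphere_proj N x)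
      = exp ((\<Sum>i<N. ln (\<phi> (sphere_proj N x i))) + real N * D / 2)"
      using N by (simp add: sphere_test_def exp_add[symmetric] D_def field_simps)
    also have "\<dots> \<le> exp (e + (\<Sum>i<N. ln (\<phi> (x i))))"
    proof -
      have "(\<Sum>i<N. ln (\<phi> (sphere_proj N x i))) - (\<Sum>i<N. ln (\<phi> (x i))) \<le> err N * (1 + real N * D\<^sup>2)"
        using sum_ln_diff[OF N x] by (simp add: D_def)
      also have "\<dots> \<le> err N * (1 + 4)" using D by (intro mult_left_mono err_nonneg) simp
      finally have 1: "(\<Sum>i<N. ln (\<phi> (sphere_proj N x i))) \<le> 5 * err N + (\<Sum>i<N. ln (\<phi> (x i)))" by simp
      have "(sqrt N * D)\<^sup>2 \<le> 2\<^sup>2" using D by (simp add: power_mult_distrib)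
      then have "sqrt N * D \<le> 2" by (rule power2_le_imp_le) simp
      then have "sqrt N * (sqrt N * D) \<le> sqrt N * 2" by (intro mult_left_mono) auto
      then have "real N * D / 2 \<le> sqrt N" by (simp add: mult.assoc[symmetric])
      also have "\<dots> \<le> real N powr (3 / 4)"
        using N by (subst powr_half_sqrt[symmetric]) (auto intro!: powr_mono)
      finally show ?thesis using 1 by (simp add: e_def)
    qed
    also have "\<dots> = exp e * (\<Prod>i<N. \<phi> (x i))"
      using test_pos by (simp add: exp_add exp_sum)
    finally show ?thesis .
  qed
  have "ennreal (1 / 2) * I \<le> (\<integral>\<^sup>+x. indicator A (norm_pow N x) \<partial>?G) * I"
    using half by (rule mult_right_mono) simp
  also have "\<dots> = (\<integral>\<^sup>+x. indicator A (norm_pow N x) * ennreal (sphere_test N (sphere_proj N x)) \<partial>?G)"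
    unfolding I_def by (rule nn_integral_polar_normal[OF N, symmetric]) measurable
  also have "\<dots> = (\<integral>\<^sup>+x. ennreal (\<Prod>i<N. std_normal_density (x i)) *
      (indicator A (norm_pow N x) * ennreal (sphere_test N (sphere_proj N x))) \<partial>measure_pow lborel N)"
    by (rule g.nn_integral_measure_pow_mu) measurable
  also have "\<dots> \<le> (\<integral>\<^sup>+x. ennreal (exp e) * (\<Prod>i<N. ennreal (\<phi> (x i))) \<partial>measure_pow lborel N)"
  proof (rule nn_integral_mono_AE)
    show "AE x in measure_pow lborel N. ennreal (\<Prod>i<N. std_normal_density (x i)) *
        (indicator A (norm_pow N x) * ennreal (sphere_test N (sphere_proj N x)))
      \<le> ennreal (exp e) * (\<Prod>i<N. ennreal (\<phi> (x i)))"
      using AE_lborel_norm_pow_nonzero[OF N]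
    proof eventually_elim
      case (elim x)
      show ?case
      proof (cases "norm_pow N x \<in> A")
        case True
        have "ennreal (\<Prod>i<N. std_normal_density (x i)) * ennreal (sphere_test N (sphere_proj N x))
            = ennreal ((\<Prod>i<N. std_normal_density (x i)) * sphere_test N (sphere_proj N x))"
          by (intro ennreal_mult[symmetric] prod_nonneg) (auto simp: sphere_test_def)
        also have "\<dots> \<le> ennreal (exp e * (\<Prod>i<N. \<phi> (x i)))" by (intro ennreal_leI pt elim True)
        also have "\<dots> = ennreal (exp e) * ennreal (\<Prod>i<N. \<phi> (x i))"
          by (intro ennreal_mult prod_nonneg) (auto intro: less_imp_le[OF test_pos])
        also have "ennreal (\<Prod>i<N. \<phi> (x i)) = (\<Prod>i<N. ennreal (\<phi> (x i)))"
          by (intro prod_ennreal[symmetric] less_imp_le[OF test_pos])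
        finally show ?thesis using True by simp
      qed simp
    qed
  qed
  also have "\<dots> = ennreal (exp e) * (\<Prod>i<N. \<integral>\<^sup>+x. ennreal (\<phi> x) \<partial>lborel)"
  proof -
    interpret product_sigma_finite "\<lambda>_::nat. lborel :: real measure" ..
    have eq: "(\<integral>\<^sup>+x. (\<Prod>i<N. ennreal (\<phi> (x i))) \<partial>measure_pow lborel N) = (\<Prod>i<N. \<integral>\<^sup>+x. ennreal (\<phi> x) \<partial>lborel)"
      unfolding measure_pow_def by (rule product_nn_integral_prod) auto
    show ?thesis by (subst nn_integral_cmult) (measurable, simp only: eq)
  qed
  also have "\<dots> \<le> ennreal (exp e) * 1"
    using test_total by (intro mult_left_mono) (simp_all add: power_le_one)
  finally have "ennreal 2 * (ennreal (1 / 2) * I) \<le> ennreal 2 * ennreal (exp e)" by (intro mult_left_mono) simp_all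
  moreover have "ennreal 2 * (ennreal (1 / 2) * I) = I"
    by (simp only: mult.assoc[symmetric] ennreal_mult[symmetric]) simp
  ultimately show ?thesis by (simp only: I_def e_def ennreal_mult[symmetric]) (simp add: ennreal_mult)
qed

end

section \<open>The lower entropy bound\<close>

text \<open>Ties the test density to \<open>f\<close>. The lower bound by (1 - \<epsilon>) f
  compares the logarithms; the upper bound \<open>B\<close> makes the logarithm of the test function
  integrable.\<close>

locale mixed_density = bounded_density f M + test_density \<phi> L \<epsilon>
  for f M \<phi> L \<epsilon> +
  fixes B :: real
  assumes \<epsilon>_lt_1: "\<epsilon> < 1"
    and test_ge: "\<And>x. (1 - \<epsilon>) * f x \<le> \<phi> x"
    and test_le: "\<And>x. \<phi> x \<le> B"
begin

lemma ln_test_ge: "0 < f x \<Longrightarrow> ln (f x) + ln (1 - \<epsilon>) \<le> ln (\<phi> x)"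
proof -
  assume "0 < f x"
  then have "ln (f x) + ln (1 - \<epsilon>) = ln ((1 - \<epsilon>) * f x)" using \<epsilon>_lt_1 by (simp add: ln_mult)
  also have "\<dots> \<le> ln (\<phi> x)" using test_ge[of x] \<epsilon>_lt_1 \<open>0 < f x\<close> by (intro ln_mono) (auto simp: test_pos)
  finally show ?thesis .
qed

text \<open>The Donsker-Varadhan bound as a Gibbs inequality: \<open>a\<close> is the density on the
  sphere and \<open>b\<close> the normalised test function, both composed with the projection. The
  mean of ln b is computed back in product space. There the mixture costs N ln (1 - \<epsilon>),
  moving the points costs \<open>err N\<close> times 1 plus the variance of x^2, and the
  normalisation costs ln Z, which contains another 5 \<open>err N\<close>; hence the number
  6.\<close>

lemma projected_entropy_ge:
  assumes N: "N \<ge> 1" and k: "k \<in> borel_measurable (borel_pow N)" "\<And>y. 0 \<le> k y"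
    "density (sphere_uniform N) (\<lambda>y. ennreal (k y)) = projected_pow \<mu> N"
    and k_pos: "AE x in measure_pow \<mu> N. 0 < k (sphere_proj N x)"
  shows "real N * (normal_entropy + ln (1 - \<epsilon>)) - err N * (6 + (\<integral>x. (x\<^sup>2 - 1)\<^sup>2 \<partial>\<mu>)) - real N powr (3 / 4) - ln 2
    \<le> (\<integral>x. ln (k (sphere_proj N x)) \<partial>measure_pow \<mu> N)"
proof -
  let ?P = "measure_pow \<mu> N"
  interpret P: prob_space ?P by (intro prob_space_measure_pow prob_space_axioms)
  note k(1)[measurable]
  define V where "V = (\<integral>x. (x\<^sup>2 - 1)\<^sup>2 \<partial>\<mu>)"
  \<comment> \<open>The upper bound for the exponential integral of the test function, not its exact
    value; dividing by it makes the mean of b/a at most 1.\<close>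
  define Z where "Z = 2 * exp (5 * err N + real N powr (3 / 4))"
  have Z: "Z > 0" by (simp add: Z_def)
  define dev where "dev x = real N * (1 - (norm_pow N x)\<^sup>2 / real N)\<^sup>2" for x
  have [measurable]: "dev \<in> borel_measurable (borel_pow N)" unfolding dev_def by measurable
  have dev_int: "integrable ?P dev" "(\<integral>x. dev x \<partial>?P) = V"
    using norm_pow_deviation[OF N] by (simp_all add: dev_def[abs_def] V_def has_bochner_integral_iff)
  define s where "s x = (\<Sum>i<N. ln (f (x i)))" for x
  define t where "t x = (\<Sum>i<N. ln (\<phi> (sphere_proj N x i)))" for x
  have [measurable]: "s \<in> borel_measurable (borel_pow N)" "t \<in> borel_measurable (borel_pow N)"
    unfolding s_def t_def by measurable
  have s_int: "integrable ?P s" "(\<integral>x. s x \<partial>?P) = real N * (\<integral>x. ln (f x) \<partial>\<mu>)"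
    unfolding s_def by (rule integrable_sum_ln, rule integral_sum_ln)
  \<comment> \<open>A minorant of \<open>t\<close> built from unprojected coordinates, whose mean is
    explicit by independence. It also gives one side of the integrability of
    \<open>t\<close>.\<close>
  define low where "low x = s x + real N * ln (1 - \<epsilon>) - err N * (1 + dev x)" for x
  have low_int: "integrable ?P low" unfolding low_def using s_int dev_int by simp
  have t_ge: "AE x in ?P. low x \<le> t x"
    using AE_measure_pow_pos AE_norm_pow_nonzero[OF N]
  proof eventually_elim
    case (elim x)
    have "s x + real N * ln (1 - \<epsilon>) = (\<Sum>i<N. ln (f (x i)) + ln (1 - \<epsilon>))" by (simp add: s_def sum.distrib)
    also have "\<dots> \<le> (\<Sum>i<N. ln (\<phi> (x i)))" using elim by (intro sum_mono ln_test_ge) auto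
    finally show ?case using sum_ln_diff[OF N elim(2)] by (simp add: t_def low_def dev_def)
  qed
  have t_le: "t x \<le> real N * \<bar>ln B\<bar>" for x
  proof -
    have "ln (\<phi> y) \<le> \<bar>ln B\<bar>" for y
      using test_pos[of y] test_le[of y] ln_mono[of "\<phi> y" B] by linarith
    then have "t x \<le> (\<Sum>i<N. \<bar>ln B\<bar>)" unfolding t_def by (intro sum_mono)
    then show ?thesis by simp
  qed
  have t_int: "integrable ?P t"
  proof (rule Bochner_Integration.integrable_bound)
    show "integrable ?P (\<lambda>x. \<bar>low x\<bar> + real N * \<bar>ln B\<bar>)" using low_int by simp
    show "AE x in ?P. norm (t x) \<le> norm (\<bar>low x\<bar> + real N * \<bar>ln B\<bar>)"
      using t_ge
    proof eventually_elim
      case (elim x)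
      have "0 \<le> real N * \<bar>ln B\<bar>" by simp
      then show ?case using elim t_le[of x] unfolding real_norm_def by linarith
    qed
  qed measurable
  define a where "a x = k (sphere_proj N x)" for x
  define b where "b x = sphere_test N (sphere_proj N x) / Z" for x
  have [measurable]: "a \<in> borel_measurable (borel_pow N)" "b \<in> borel_measurable (borel_pow N)"
    unfolding a_def b_def by measurable
  have ln_b: "ln (b x) = t x + real N * (ln (2 * pi) + 1) / 2 - ln Z" for x
    using Z unfolding b_def sphere_test_def t_def by (subst ln_div) simp_all
  have "(\<integral>\<^sup>+x. ennreal (b x / a x) \<partial>?P)
      = (\<integral>\<^sup>+y. ennreal (k y) * ennreal (sphere_test N y / Z / k y) \<partial>sphere_uniform N)"
    unfolding a_def b_def by (rule nn_integral_projected_density[OF N k(1) _ k(3)]) measurable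
  \<comment> \<open>The density \<open>k\<close> cancels where it is positive; where it is zero the
    left integrand is 0.\<close>
  also have "\<dots> \<le> (\<integral>\<^sup>+y. ennreal (1 / Z) * ennreal (sphere_test N y) \<partial>sphere_uniform N)"
    using k(2) Z
    by (intro nn_integral_mono) (auto simp: ennreal_mult[symmetric] sphere_test_def intro!: ennreal_leI)
  also have "\<dots> = ennreal (1 / Z) * (\<integral>\<^sup>+y. ennreal (sphere_test N y) \<partial>sphere_uniform N)"
    by (intro nn_integral_cmult) measurable
  also have "\<dots> \<le> ennreal (1 / Z) * ennreal Z"
    unfolding Z_def by (intro mult_left_mono nn_integral_sphere_test_le N) simp
  also have "\<dots> = 1" using Z by (simp add: ennreal_mult[symmetric])
  finally have ba: "(\<integral>\<^sup>+x. ennreal (b x / a x) \<partial>?P) \<le> 1" .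
  have b_pos: "AE x in ?P. 0 < b x" using Z by (simp add: b_def sphere_test_def)
  have a_pos: "AE x in ?P. 0 < a x" using k_pos by (simp add: a_def)
  have int_a: "integrable ?P (\<lambda>x. ln (a x))"
    unfolding a_def by (rule projected_entropy(1)[OF N k k_pos])
  have int_b: "integrable ?P (\<lambda>x. ln (b x))" using t_int by (simp add: ln_b)
  have "real N * (\<integral>x. ln (f x) \<partial>\<mu>) + real N * ln (1 - \<epsilon>) - err N * (1 + V) = (\<integral>x. low x \<partial>?P)"
    unfolding low_def using s_int dev_int P.prob_space by simp
  also have "\<dots> \<le> (\<integral>x. t x \<partial>?P)" by (rule integral_mono_AE[OF low_int t_int t_ge])
  also have "\<dots> = (\<integral>x. ln (b x) \<partial>?P) - real N * (ln (2 * pi) + 1) / 2 + ln Z"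
    using t_int P.prob_space by (simp add: ln_b)
  also have "(\<integral>x. ln (b x) \<partial>?P) \<le> (\<integral>x. ln (a x) \<partial>?P)"
    by (rule Gibbs_inequality[OF P.prob_space_axioms _ _ a_pos b_pos ba int_a int_b]) measurable
  finally have main: "real N * (\<integral>x. ln (f x) \<partial>\<mu>) + real N * ln (1 - \<epsilon>) - err N * (1 + V)
     \<le> (\<integral>x. ln (a x) \<partial>?P) - real N * (ln (2 * pi) + 1) / 2 + ln Z" by simp
  have "ln Z = ln 2 + (5 * err N + real N powr (3 / 4))" by (simp add: Z_def ln_mult)
  then have "real N * (\<integral>x. ln (f x) \<partial>\<mu>) + real N * (ln (2 * pi) + 1) / 2 + real N * ln (1 - \<epsilon>)
      - err N * (6 + V) - real N powr (3 / 4) - ln 2 \<le> (\<integral>x. ln (a x) \<partial>?P)"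
    using main by (simp add: algebra_simps)
  also have "real N * (\<integral>x. ln (f x) \<partial>\<mu>) + real N * (ln (2 * pi) + 1) / 2 + real N * ln (1 - \<epsilon>)
    = real N * (normal_entropy + ln (1 - \<epsilon>))" by (simp add: normal_entropy_def algebra_simps add_divide_distrib)
  finally show ?thesis by (simp add: a_def V_def)
qed

end

section \<open>Kac chaos\<close>

lemma kac_sphere_sets: "kac_sphere N \<in> sets (borel_pow N)"
proof -
  have "kac_sphere N = {x \<in> space (borel_pow N). (\<Sum>i<N. (x i)\<^sup>2) = real N}"
    by (simp add: kac_sphere_def space_PiM)
  also have "\<dots> \<in> sets (borel_pow N)" by measurable
  finally show ?thesis .
qed

text \<open>On the full sequence space the Borel sets of the product topology are the product
  sigma-algebra. So \<phi> is composed with the restriction, which is continuous there, and the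
  result is pulled back along extension by zero.\<close>

lemma continuous_map_powertop_imp_measurable:
  assumes "continuous_map (powertop_real {..<j}) euclideanreal \<phi>"
  shows "\<phi> \<in> borel_measurable (borel_pow j)"
proof -
  define r where "r x = restrict x {..<j}" for x :: "nat \<Rightarrow> real"
  have "continuous_map euclidean (powertop_real {..<j}) r"
    by (simp add: continuous_map_componentwise r_def image_subset_iff)
  from continuous_map_compose[OF this assms] have "continuous_on UNIV (\<phi> \<circ> r)"
    by (simp only: continuous_map_iff_continuous2)
  then have 1: "\<phi> \<circ> r \<in> borel_measurable (PiM UNIV (\<lambda>_. borel))"
    using borel_measurable_continuous_onI measurable_cong_sets[OF sets_PiM_equal_borel refl] by blast
  have "(\<lambda>x i. if i < j then x i else 0) \<in> borel_pow j \<rightarrow>\<^sub>M (PiM UNIV (\<lambda>_. borel) :: (nat \<Rightarrow> real) measure)"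
  proof (rule measurable_PiM_single')
    show "(\<lambda>x. if i < j then x i else 0) \<in> borel_measurable (borel_pow j)" for i
      by (cases "i < j") simp_all
  qed (simp add: space_PiM)
  from measurable_compose[OF this 1] show ?thesis
  proof (rule measurable_cong[THEN iffD1, rotated])
    fix x assume "x \<in> space (borel_pow j)"
    then show "(\<phi> \<circ> r) (\<lambda>i. if i < j then x i else 0) = \<phi> x"
      by (auto simp: r_def space_PiM PiE_iff extensional_def intro!: arg_cong[where f=\<phi>])
  qed
qed

lemma continuous_on_dilate:
  assumes "continuous_map (powertop_real {..<j}) euclideanreal \<phi>"
  shows "continuous_on UNIV (\<lambda>s. \<phi> (dilate j s y))"
proof -
  have "continuous_map euclideanreal (powertop_real {..<j}) (\<lambda>s. dilate j s y)"
    by (auto simp: continuous_map_componentwise dilate_def image_subset_iff intro!: continuous_on_mult_right continuous_on_id)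
  from continuous_map_compose[OF this assms] show ?thesis
    by (simp only: continuous_map_iff_continuous2 o_def)
qed

context bounded_density
begin

text \<open>The norm is symmetric in the coordinates, so permuting them commutes with the
  projection; the product law is invariant.\<close>

lemma permutation_invariant_projected_pow: "permutation_invariant N (projected_pow \<mu> N)"
  unfolding permutation_invariant_def
proof (intro allI impI)
  fix \<pi> :: "nat \<Rightarrow> nat" assume \<pi>: "\<pi> permutes {..<N}"
  define S where "S x = (\<lambda>i\<in>{..<N}. x (\<pi> i))" for x :: "nat \<Rightarrow> real"
  have \<pi>_less: "\<pi> i < N \<longleftrightarrow> i < N" for i using permutes_in_image[OF \<pi>, of i] by simp
  have S_meas[measurable]: "S \<in> borel_pow N \<rightarrow>\<^sub>M borel_pow N"
    unfolding S_def by (intro measurable_restrict measurable_component_singleton) (simp add: \<pi>_less)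
  have norm_S: "norm_pow N (S x) = norm_pow N x" for x
    using sum.permute[OF \<pi>, of "\<lambda>i. (x i)\<^sup>2"] by (simp add: norm_pow_def S_def)
  have comm: "S (sphere_proj N x) = sphere_proj N (S x)" for x
    unfolding sphere_proj_def norm_S by (auto simp: S_def \<pi>_less)
  have P: "distr (measure_pow \<mu> N) (borel_pow N) S = measure_pow \<mu> N"
  proof -
    have "distr (PiM {..<N} (\<lambda>_. \<mu>)) (PiM {..<N} (\<lambda>_. \<mu>)) (\<lambda>x. \<lambda>i\<in>{..<N}. x (\<pi> i)) = PiM {..<N} (\<lambda>_. \<mu>)"
      using distr_PiM_reindex[of "{..<N}" "\<lambda>_. \<mu>" \<pi> "{..<N}"] prob_space_axioms permutes_inj_on[OF \<pi>] \<pi>_less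
      by auto
    then show ?thesis
      using sets_measure_pow_density[of f N] by (simp add: measure_pow_def S_def[abs_def] cong: distr_cong)
  qed
  have "distr (projected_pow \<mu> N) (borel_pow N) S = distr (measure_pow \<mu> N) (borel_pow N) (\<lambda>x. S (sphere_proj N x))"
    unfolding projected_pow_def by (subst distr_distr) (measurable, simp add: o_def)
  also have "\<dots> = distr (distr (measure_pow \<mu> N) (borel_pow N) S) (borel_pow N) (sphere_proj N)"
    unfolding comm by (subst distr_distr) (measurable, simp add: o_def)
  also have "\<dots> = projected_pow \<mu> N" by (simp add: P projected_pow_def)
  finally show "distr (projected_pow \<mu> N) (borel_pow N) (\<lambda>x. \<lambda>i\<in>{..<N}. x (\<pi> i)) = projected_pow \<mu> N"
    by (simp add: S_def[abs_def])
qed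

lemma measure_pow_restrict:
  assumes "j \<le> N"
  shows "distr (measure_pow \<mu> N) (borel_pow j) (\<lambda>x. restrict x {..<j}) = measure_pow \<mu> j"
proof -
  interpret product_prob_space "\<lambda>_::nat. \<mu>" ..
  have "PiM {..<j} (\<lambda>_. \<mu>) = distr (PiM {..<N} (\<lambda>_. \<mu>)) (PiM {..<j} (\<lambda>_. \<mu>)) (\<lambda>x. restrict x {..<j})"
    using assms by (intro distr_restrict) auto
  then show ?thesis
    using sets_measure_pow_density[of f j] by (simp add: measure_pow_def cong: distr_cong)
qed

text \<open>A bounded continuous function need not be uniformly continuous, so a common \<delta> is
  available only off a set of small measure. As in Egorov's theorem, the points at which some
  dilation within 1 / (n + 1) of the identity changes \<phi> by more than e form a decreasing
  sequence of sets; continuity at dilation factor 1 makes the intersection empty.\<close>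

lemma dilation_modulus:
  assumes cont: "continuous_map (powertop_real {..<j}) euclideanreal \<phi>" and "e > 0"
  obtains A \<delta> where "A \<in> sets (borel_pow j)" "\<delta> > 0" "measure (measure_pow \<mu> j) A < e"
    "\<And>y s. y \<in> space (borel_pow j) \<Longrightarrow> y \<notin> A \<Longrightarrow> \<bar>s - 1\<bar> < \<delta> \<Longrightarrow> \<bar>\<phi> (dilate j s y) - \<phi> y\<bar> \<le> e"
proof -
  interpret P: prob_space "measure_pow \<mu> j" by (intro prob_space_measure_pow prob_space_axioms)
  note m[measurable] = continuous_map_powertop_imp_measurable[OF cont]
  \<comment> \<open>Rational factors make the set a countable union of measurable sets. Real factors
    are recovered at the end: the set of bad factors is open, so if it is nonempty it contains a
    rational.\<close>
  define A where "A n = {y \<in> space (borel_pow j). \<exists>q\<in>\<rat>. \<bar>q - 1\<bar> < 1 / real (Suc n) \<and> e < \<bar>\<phi> (dilate j q y) - \<phi> y\<bar>}" for n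
  have A_meas: "A n \<in> sets (borel_pow j)" for n
  proof -
    have "A n = (\<Union>q\<in>\<rat> \<inter> {q. \<bar>q - 1\<bar> < 1 / real (Suc n)}. {y \<in> space (borel_pow j). e < \<bar>\<phi> (dilate j q y) - \<phi> y\<bar>})"
      by (auto simp: A_def)
    also have "\<dots> \<in> sets (borel_pow j)"
      by (intro sets.countable_UN'' countable_Int1 countable_rat) measurable
    finally show ?thesis .
  qed
  have "decseq A"
  proof (rule decseq_SucI)
    fix n
    have "1 / real (Suc (Suc n)) \<le> 1 / real (Suc n)" by (intro divide_left_mono) auto
    then have "\<bar>q - 1\<bar> < 1 / real (Suc n)" if "\<bar>q - 1\<bar> < 1 / real (Suc (Suc n))" for q :: real
      using that by linarith
    then show "A (Suc n) \<subseteq> A n" unfolding A_def by blast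
  qed
  have dil1: "dilate j 1 y = y" if "y \<in> space (borel_pow j)" for y
    using that by (auto simp: dilate_def space_PiM PiE_iff extensional_def)
  have "(\<Inter>n. A n) = {}"
  proof (rule ccontr)
    assume "(\<Inter>n. A n) \<noteq> {}"
    then obtain y where y: "\<And>n. y \<in> A n" by blast
    then have ysp: "y \<in> space (borel_pow j)" by (auto simp: A_def)
    have "((\<lambda>s. \<phi> (dilate j s y)) \<longlongrightarrow> \<phi> (dilate j 1 y)) (at 1)"
      using continuous_on_dilate[OF cont, of y] by (simp add: continuous_on_eq_continuous_at isCont_def)
    then obtain d where d: "d > 0" "\<And>s. s \<noteq> 1 \<Longrightarrow> \<bar>s - 1\<bar> < d \<Longrightarrow> \<bar>\<phi> (dilate j s y) - \<phi> y\<bar> < e"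
      using \<open>e > 0\<close> unfolding LIM_def dist_real_def dil1[OF ysp] by blast
    obtain n where "1 / real (Suc n) < d" using nat_approx_posE[OF d(1)] by (auto simp: divide_inverse)
    then have "\<bar>\<phi> (dilate j q y) - \<phi> y\<bar> \<le> e" if "\<bar>q - 1\<bar> < 1 / real (Suc n)" for q
      using that d(2)[of q] \<open>e > 0\<close> dil1[OF ysp] by (cases "q = 1") auto
    moreover obtain q where "\<bar>q - 1\<bar> < 1 / real (Suc n)" "e < \<bar>\<phi> (dilate j q y) - \<phi> y\<bar>"
      using y[of n] unfolding A_def by blast
    ultimately show False by (meson not_le)
  qed
  moreover have "(\<lambda>n. measure (measure_pow \<mu> j) (A n)) \<longlonglongrightarrow> measure (measure_pow \<mu> j) (\<Inter>n. A n)"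
    using A_meas \<open>decseq A\<close> by (intro P.finite_Lim_measure_decseq) (auto simp: sets_measure_pow)
  ultimately have "\<forall>\<^sub>F n in sequentially. measure (measure_pow \<mu> j) (A n) < e"
    using \<open>e > 0\<close> by (auto dest: order_tendstoD(2))
  then obtain n where n: "measure (measure_pow \<mu> j) (A n) < e" by (auto simp: eventually_sequentially)
  show thesis
  proof (rule that[OF A_meas _ n, of "1 / real (Suc n)"])
    fix y s assume y: "y \<in> space (borel_pow j)" "y \<notin> A n" and s: "\<bar>s - 1\<bar> < 1 / real (Suc n)"
    show "\<bar>\<phi> (dilate j s y) - \<phi> y\<bar> \<le> e"
    proof (rule ccontr)
      assume large: "\<not> \<bar>\<phi> (dilate j s y) - \<phi> y\<bar> \<le> e"
      define U where "U = {s. e < \<bar>\<phi> (dilate j s y) - \<phi> y\<bar>} \<inter> ball 1 (1 / real (Suc n))"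
      have "open U" unfolding U_def
        by (intro open_Int open_ball open_Collect_less continuous_intros continuous_on_dilate[OF cont])
      moreover have "s \<in> U" using s large by (auto simp: U_def dist_real_def abs_minus_commute)
      ultimately obtain d where d: "d > 0" "ball s d \<subseteq> U" by (meson openE)
      obtain q where q: "q \<in> \<rat>" "s < q" "q < s + d" using Rats_dense_in_real[of s "s + d"] d by auto
      then have "q \<in> U" using d by (auto simp: dist_real_def subset_iff)
      then show False using y q(1) by (auto simp: U_def A_def dist_real_def abs_minus_commute)
    qed
  qed simp
qed

text \<open>The first j coordinates of the projected point are those of the point, dilated by the
  single factor sqrt N / |x|. This factor tends to 1 in probability, by the bound on the deviation
  of the radius. Off the exceptional set \<open>A\<close> and the event that the radius is far from
  sqrt N, \<phi> changes by at most e; on these it changes by at most 2 C.\<close>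

lemma weakly_converges_marginal:
  "weakly_converges (powertop_real {..<j}) (\<lambda>N. marginal j (projected_pow \<mu> N)) (measure_pow \<mu> j)"
  unfolding weakly_converges_def
proof (intro allI impI, elim conjE)
  fix \<phi> :: "(nat \<Rightarrow> real) \<Rightarrow> real"
  assume cont: "continuous_map (powertop_real {..<j}) euclideanreal \<phi>"
    and bdd: "bounded (\<phi> ` topspace (powertop_real {..<j}))"
  obtain C where C: "C > 0" "\<And>y. y \<in> space (borel_pow j) \<Longrightarrow> \<bar>\<phi> y\<bar> \<le> C"
    using bdd unfolding bounded_pos by (auto simp: space_PiM)
  note m[measurable] = continuous_map_powertop_imp_measurable[OF cont]
  define V where "V = (\<integral>x. (x\<^sup>2 - 1)\<^sup>2 \<partial>\<mu>)"
  interpret Pj: prob_space "measure_pow \<mu> j" by (intro prob_space_measure_pow prob_space_axioms)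
  show "(\<lambda>N. \<integral>x. \<phi> x \<partial>marginal j (projected_pow \<mu> N)) \<longlonglongrightarrow> (\<integral>x. \<phi> x \<partial>measure_pow \<mu> j)"
  proof (rule LIMSEQ_I)
    fix r :: real assume r: "r > 0"
    \<comment> \<open>The budget is e for the good points and 2 C e for each of the two bad events;
      the spare e makes the final inequality strict.\<close>
    define e where "e = r / (2 + 4 * C)"
    have e: "e > 0" "e * (2 + 4 * C) = r" using r C(1) by (simp_all add: e_def)
    obtain A \<delta> where A[measurable]: "A \<in> sets (borel_pow j)" and \<delta>: "\<delta> > 0"
      and Ae: "measure (measure_pow \<mu> j) A < e"
      and mod: "\<And>y s. y \<in> space (borel_pow j) \<Longrightarrow> y \<notin> A \<Longrightarrow> \<bar>s - 1\<bar> < \<delta> \<Longrightarrow> \<bar>\<phi> (dilate j s y) - \<phi> y\<bar> \<le> e"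
      using dilation_modulus[OF cont e(1)] by blast
    \<comment> \<open>The dilation factor is 1 / sqrt (1 - D) with D the relative deviation of the
      squared radius, so closeness to 1 becomes the event |D| < c.\<close>
    have "isCont (\<lambda>d. 1 / sqrt (1 - d)) (0::real)" by (intro continuous_intros) auto
    then obtain c where c: "c > 0" "\<And>d. \<bar>d\<bar> < c \<Longrightarrow> \<bar>1 / sqrt (1 - d) - 1\<bar> < \<delta>"
      using \<delta> unfolding continuous_at_eps_delta by (auto simp: dist_real_def)
    \<comment> \<open>The first summand makes the Chebyshev bound V / (N c^2) at most e,
      \<open>j\<close> ensures that the marginal exists, and 1 excludes N = 0.\<close>
    define N0 where "N0 = nat \<lceil>V / (c\<^sup>2 * e)\<rceil> + j + 1"
    show "\<exists>N0. \<forall>N\<ge>N0. norm ((\<integral>x. \<phi> x \<partial>marginal j (projected_pow \<mu> N)) - (\<integral>x. \<phi> x \<partial>measure_pow \<mu> j)) < r"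
    proof (intro exI[of _ N0] allI impI)
      fix N assume "N \<ge> N0"
      then have N: "N \<ge> 1" "j \<le> N" and "V / (c\<^sup>2 * e) \<le> real N" by (auto simp: N0_def) linarith
      then have VN: "V / (real N * c\<^sup>2) \<le> e" using e c by (simp add: field_simps)
      let ?P = "measure_pow \<mu> N"
      interpret P: prob_space ?P by (intro prob_space_measure_pow prob_space_axioms)
      define dev where "dev x = real N * (1 - (norm_pow N x)\<^sup>2 / real N)\<^sup>2" for x
      have dev_int: "integrable ?P dev" "(\<integral>x. dev x \<partial>?P) = V"
        using norm_pow_deviation[OF N(1)] by (simp_all add: dev_def[abs_def] V_def has_bochner_integral_iff)
      define y where "y x = restrict x {..<j}" for x :: "nat \<Rightarrow> real"
      have y_sp: "y x \<in> space (borel_pow j)" for x by (simp add: y_def space_PiM)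
      have y_meas[measurable]: "y \<in> borel_pow N \<rightarrow>\<^sub>M borel_pow j"
        unfolding y_def by (rule measurable_restrict_subset) (use N in auto)
      have proj: "y (sphere_proj N x) = dilate j (sqrt N / norm_pow N x) (y x)" for x
        using N by (auto simp: y_def dilate_def sphere_proj_def)
      have distr_y: "distr ?P (borel_pow j) y = measure_pow \<mu> j"
        unfolding y_def by (rule measure_pow_restrict) fact
      have i1: "(\<integral>x. \<phi> x \<partial>marginal j (projected_pow \<mu> N)) = (\<integral>x. \<phi> (y (sphere_proj N x)) \<partial>?P)"
        unfolding marginal_def projected_pow_def y_def[symmetric, abs_def]
        by (subst distr_distr, measurable, unfold o_def, subst integral_distr) measurable
      have i2: "(\<integral>x. \<phi> x \<partial>measure_pow \<mu> j) = (\<integral>x. \<phi> (y x) \<partial>?P)"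
        unfolding distr_y[symmetric] by (subst integral_distr) measurable
      have int1: "integrable ?P (\<lambda>x. \<phi> (y (sphere_proj N x)))"
        by (rule P.integrable_const_bound[where B = C]) (use C y_sp in auto)
      have int2: "integrable ?P (\<lambda>x. \<phi> (y x))"
        by (rule P.integrable_const_bound[where B = C]) (use C y_sp in auto)
      have int3: "integrable ?P (\<lambda>x. indicator A (y x) :: real)"
        by (rule P.integrable_const_bound[where B = 1]) (auto simp: indicator_def)
      have A_int: "(\<integral>x. indicat_real A (y x) \<partial>?P) = measure (measure_pow \<mu> j) A"
      proof -
        have "(\<integral>x. indicat_real A (y x) \<partial>?P) = (\<integral>x. indicat_real A x \<partial>measure_pow \<mu> j)"
          unfolding distr_y[symmetric] by (subst integral_distr) measurable
        then show ?thesis using A sets.sets_into_space[OF A] by (simp add: space_measure_pow space_PiM Int_absorb2)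
      qed
      have pt: "AE x in ?P. \<bar>\<phi> (y (sphere_proj N x)) - \<phi> (y x)\<bar>
          \<le> e + 2 * C * (indicator A (y x) + dev x / (real N * c\<^sup>2))"
        using AE_norm_pow_nonzero[OF N(1)]
      proof eventually_elim
        case (elim x)
        define D where "D = 1 - (norm_pow N x)\<^sup>2 / real N"
        have dev: "dev x / (real N * c\<^sup>2) = (D / c)\<^sup>2" using N c by (simp add: dev_def D_def power_divide)
        have triv: "\<bar>\<phi> (y (sphere_proj N x)) - \<phi> (y x)\<bar> \<le> 2 * C"
          using C(2)[OF y_sp, of x] C(2)[OF y_sp, of "sphere_proj N x"] by linarith
        consider "y x \<in> A" | "\<bar>D\<bar> \<ge> c" | "y x \<notin> A" "\<bar>D\<bar> < c" by linarith
        then show ?case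
        proof cases
          case 1
          have "2 * C * 1 \<le> 2 * C * (1 + (D / c)\<^sup>2)" using C by (intro mult_left_mono) auto
          then show ?thesis using 1 triv e by (simp add: dev)
        next
          case 2
          then have "1 \<le> \<bar>D / c\<bar>" using c by (simp add: field_simps)
          then have "1 \<le> (D / c)\<^sup>2" by (metis one_le_power power2_abs)
          then have "2 * C * 1 \<le> 2 * C * (indicator A (y x) + (D / c)\<^sup>2)"
            using C by (intro mult_left_mono) (auto simp: indicator_def)
          then show ?thesis using triv e by (simp add: dev)
        next
          case 3
          have "1 / sqrt (1 - D) = sqrt N / norm_pow N x"
            using norm_pow_nonneg[of N x] by (simp add: D_def real_sqrt_divide)
          then have "\<bar>\<phi> (y (sphere_proj N x)) - \<phi> (y x)\<bar> \<le> e"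
            unfolding proj using c(2)[OF 3(2)] by (intro mod y_sp 3(1)) simp
          moreover have "0 \<le> 2 * C * (indicator A (y x) + dev x / (real N * c\<^sup>2))"
            unfolding dev using C by simp
          ultimately show ?thesis by linarith
        qed
      qed
      have "\<bar>(\<integral>x. \<phi> (y (sphere_proj N x)) \<partial>?P) - (\<integral>x. \<phi> (y x) \<partial>?P)\<bar>
          = \<bar>\<integral>x. \<phi> (y (sphere_proj N x)) - \<phi> (y x) \<partial>?P\<bar>"
        using int1 int2 by simp
      also have "\<dots> \<le> (\<integral>x. \<bar>\<phi> (y (sphere_proj N x)) - \<phi> (y x)\<bar> \<partial>?P)" by (rule integral_abs_bound)
      also have "\<dots> \<le> (\<integral>x. e + 2 * C * (indicator A (y x) + dev x / (real N * c\<^sup>2)) \<partial>?P)"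
        using int1 int2 int3 dev_int pt by (intro integral_mono_AE) auto
      also have "\<dots> = e + 2 * C * (measure (measure_pow \<mu> j) A + V / (real N * c\<^sup>2))"
        using int3 dev_int P.prob_space by (simp add: A_int)
      also have "\<dots> < e + e + 2 * C * (e + e)"
        using Ae VN C e by (intro add_less_le_mono mult_left_mono add_mono) auto
      also have "\<dots> = r" using e(2) by (simp add: algebra_simps)
      finally show "norm ((\<integral>x. \<phi> x \<partial>marginal j (projected_pow \<mu> N)) - (\<integral>x. \<phi> x \<partial>measure_pow \<mu> j)) < r"
        by (simp add: i1 i2)
    qed
  qed
qed

lemma kac_chaotic_projected_pow: "kac_chaotic (projected_pow \<mu>) \<mu>"
  unfolding kac_chaotic_def
  using prob_space_projected_pow permutation_invariant_projected_pow weakly_converges_marginal by simp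

lemma AE_kac_sphere:
  assumes "N \<ge> 1"
  shows "AE x in projected_pow \<mu> N. x \<in> kac_sphere N"
  unfolding projected_pow_def
proof (subst AE_distr_iff)
  show "{x \<in> space (borel_pow N). x \<in> kac_sphere N} \<in> sets (borel_pow N)"
    using kac_sphere_sets[of N] by (simp add: sets.Int_space_eq1[symmetric] Int_def[symmetric] Collect_conj_eq)
  show "AE x in measure_pow \<mu> N. sphere_proj N x \<in> kac_sphere N"
    using AE_norm_pow_nonzero[OF assms] by eventually_elim (rule sphere_proj_mem_kac_sphere)
qed measurable

end

section \<open>The rate\<close>

context bounded_density
begin

text \<open>Hoelder constant and upper bound are both M + 1: the part M comes from \<open>f\<close>,
  and \<open>tail_density\<close> satisfies both bounds with constant 1.\<close>

lemma mixed_density_tail: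
  assumes Holder_f: "\<And>a b. \<bar>f a - f b\<bar> \<le> M * sqrt \<bar>a - b\<bar>" and \<epsilon>: "0 < \<epsilon>" "\<epsilon> < 1"
  shows "mixed_density f M (\<lambda>x. (1 - \<epsilon>) * f x + \<epsilon> * tail_density x) (M + 1) \<epsilon> (M + 1)"
proof -
  have M: "0 \<le> M" using nonneg[of 0] bounded[of 0] by simp
  have "(\<integral>\<^sup>+x. ennreal ((1 - \<epsilon>) * f x + \<epsilon> * tail_density x) \<partial>lborel)
      = (\<integral>\<^sup>+x. ennreal (1 - \<epsilon>) * ennreal (f x) + ennreal \<epsilon> * ennreal (tail_density x) \<partial>lborel)"
    using \<epsilon> nonneg tail_density_pos
    by (intro nn_integral_cong) (simp add: ennreal_mult less_imp_le)
  also have "\<dots> = ennreal (1 - \<epsilon>) * 1 + ennreal \<epsilon> * 1"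
    by (simp add: nn_integral_add nn_integral_cmult total nn_integral_tail_density)
  also have "\<dots> = 1" using \<epsilon> by (simp add: ennreal_plus[symmetric] del: ennreal_plus)
  finally have 1: "(\<integral>\<^sup>+x. ennreal ((1 - \<epsilon>) * f x + \<epsilon> * tail_density x) \<partial>lborel) = 1" .
  show ?thesis
  proof (unfold_locales)
    fix a b
    have "\<bar>(1 - \<epsilon>) * f a + \<epsilon> * tail_density a - ((1 - \<epsilon>) * f b + \<epsilon> * tail_density b)\<bar>
        = \<bar>(1 - \<epsilon>) * (f a - f b) + \<epsilon> * (tail_density a - tail_density b)\<bar>" by (simp add: algebra_simps)
    also have "\<dots> \<le> (1 - \<epsilon>) * \<bar>f a - f b\<bar> + \<epsilon> * \<bar>tail_density a - tail_density b\<bar>"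
      using \<epsilon> abs_triangle_ineq[of "(1 - \<epsilon>) * (f a - f b)" "\<epsilon> * (tail_density a - tail_density b)"]
      by (simp add: abs_mult)
    also have "\<dots> \<le> 1 * (M * sqrt \<bar>a - b\<bar>) + 1 * sqrt \<bar>a - b\<bar>"
      using \<epsilon> Holder_f tail_density_Holder by (intro add_mono mult_mono) auto
    finally show "\<bar>(1 - \<epsilon>) * f a + \<epsilon> * tail_density a - ((1 - \<epsilon>) * f b + \<epsilon> * tail_density b)\<bar> \<le> (M + 1) * sqrt \<bar>a - b\<bar>"
      by (simp add: algebra_simps)
  next
    fix x
    have "(1 - \<epsilon>) * f x + \<epsilon> * tail_density x \<le> 1 * M + 1 * 1"
      using \<epsilon> M nonneg bounded tail_density_le less_imp_le[OF tail_density_pos]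
      by (intro add_mono mult_mono) auto
    then show "(1 - \<epsilon>) * f x + \<epsilon> * tail_density x \<le> M + 1" by simp
  qed (use \<epsilon> M 1 nonneg less_imp_le[OF tail_density_pos] in auto)
qed

text \<open>The function \<open>h\<close> is the entropy per coordinate. It never exceeds its limit,
  by the data processing bound, so the rate is a statement about the lower bound alone.\<close>

lemma projected_entropy_rate:
  assumes Holder_f: "\<And>a b. \<bar>f a - f b\<bar> \<le> M * sqrt \<bar>a - b\<bar>"
  obtains C h where "C > 0"
    "\<And>N. N \<ge> 1 \<Longrightarrow> relative_entropy (projected_pow \<mu> N) (sphere_uniform N) = ereal (real N * h N)"
    "\<And>N. N \<ge> 1 \<Longrightarrow> \<bar>h N - normal_entropy\<bar> \<le> C * real N powr (- 1 / 8)"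
proof -
  define V where "V = (\<integral>x. (x\<^sup>2 - 1)\<^sup>2 \<partial>\<mu>)"
  have V: "V \<ge> 0" by (simp add: V_def)
  have M: "0 \<le> M" using nonneg[of 0] bounded[of 0] by simp
  \<comment> \<open>The 3 collects three errors of size q per coordinate: from ln (1 - \<epsilon>),
    from N^(3/4) and from ln 2. The number 96 is 48 / \<epsilon> with \<epsilon> = q / 2, the
    remaining 1/q turning N^(3/4) into N q.\<close>
  define C where "C = 3 + 96 * (M + 1) * (6 + V)"
  define h where "h N = real_of_ereal (relative_entropy (projected_pow \<mu> N) (sphere_uniform N)) / real N" for N
  have C: "C > 0" unfolding C_def using M V by (intro add_pos_nonneg mult_nonneg_nonneg) auto
  have main: "relative_entropy (projected_pow \<mu> N) (sphere_uniform N) = ereal (real N * h N) \<and>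
      \<bar>h N - normal_entropy\<bar> \<le> C * real N powr (- 1 / 8)" if N: "N \<ge> 1" for N
  proof -
    obtain k where k: "k \<in> borel_measurable (borel_pow N)" "\<And>y. 0 \<le> k y"
      "density (sphere_uniform N) (\<lambda>y. ennreal (k y)) = projected_pow \<mu> N"
      and k_pos: "AE x in measure_pow \<mu> N. 0 < k (sphere_proj N x)"
      using projected_pow_density[OF N] by blast
    define q where "q = real N powr (- 1 / 8)"
    have q: "0 < q" "q \<le> 1" using N by (auto simp: q_def powr_minus_divide ge_one_powr_ge_zero)
    have q78: "real N powr (7 / 8) = real N * q"
      using N powr_add[of "real N" 1 "-1/8"] by (simp add: q_def)
    have "real N powr (3 / 4) \<le> real N powr (7 / 8)" using N by (intro powr_mono) auto
    then have q34: "real N powr (3 / 4) \<le> real N * q" by (simp add: q78)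
    have "1 \<le> real N powr (7 / 8)" using N by (simp add: ge_one_powr_ge_zero)
    then have ln2: "ln 2 \<le> real N * q" using ln_le_minus_one[of "2 :: real"] by (simp add: q78)
    \<comment> \<open>Halving keeps \<epsilon> at most 1/2 even for N = 1, where q = 1. Then ln (1 -
      \<epsilon>) \<ge> -\<epsilon> - 2 \<epsilon>^2 \<ge> -2 \<epsilon> = -q.\<close>
    define \<epsilon> where "\<epsilon> = q / 2"
    have \<epsilon>: "0 < \<epsilon>" "\<epsilon> < 1" "\<epsilon> \<le> 1 / 2" using q by (auto simp: \<epsilon>_def)
    interpret T: mixed_density f M "\<lambda>x. (1 - \<epsilon>) * f x + \<epsilon> * tail_density x" "M + 1" \<epsilon> "M + 1"
      by (rule mixed_density_tail[OF Holder_f \<epsilon>(1,2)])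
    define E where "E = (\<integral>x. ln (k (sphere_proj N x)) \<partial>measure_pow \<mu> N)"
    have rel: "relative_entropy (projected_pow \<mu> N) (sphere_uniform N) = ereal E"
      unfolding E_def by (rule projected_entropy(3)[OF N k k_pos])
    have E: "E = real N * h N" using N by (simp add: h_def rel)
    have "real N * h N \<le> real N * normal_entropy"
      unfolding E[symmetric] E_def by (rule projected_entropy(2)[OF N k k_pos])
    then have upper: "h N \<le> normal_entropy" using N by simp
    have err: "T.err N = 96 * (M + 1) * (real N * q)"
    proof -
      have "T.err N = 96 * (M + 1) * (real N powr (3 / 4) / q)"
        unfolding T.err_def by (simp add: \<epsilon>_def)
      also have "real N powr (3 / 4) / q = real N powr (3 / 4 - - 1 / 8)"
        unfolding q_def by (rule powr_diff[symmetric])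
      finally show ?thesis by (simp add: q78)
    qed
    have "- q \<le> ln (1 - \<epsilon>)"
    proof -
      have "\<epsilon>\<^sup>2 \<le> \<epsilon> * (1 / 2)" using \<epsilon> unfolding power2_eq_square by (intro mult_left_mono) auto
      then show ?thesis using ln_one_minus_pos_lower_bound[of \<epsilon>] \<epsilon> by (simp add: \<epsilon>_def)
    qed
    then have "real N * (normal_entropy - q) \<le> real N * (normal_entropy + ln (1 - \<epsilon>))"
      by (intro mult_left_mono) auto
    also have "\<dots> \<le> E + T.err N * (6 + V) + real N powr (3 / 4) + ln 2"
      using T.projected_entropy_ge[OF N k k_pos] by (simp add: E_def V_def)
    also have "\<dots> \<le> real N * h N + 96 * (M + 1) * (real N * q) * (6 + V) + real N * q + real N * q"
      unfolding err E using q34 ln2 by (intro add_mono) auto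
    finally have "real N * normal_entropy \<le> real N * (h N + C * q)"
      by (simp add: C_def algebra_simps)
    then have "normal_entropy \<le> h N + C * q" using N by simp
    then show ?thesis using upper rel E C q by (auto simp: q_def abs_le_iff add_increasing2)
  qed
  show thesis
    by (rule that[OF C, of h]) (use main in auto)
qed

end

theorem theorem32:
  fixes f :: "real \<Rightarrow> real" and k p :: real
  assumes "k > 4" and "p > 1"
    and "f \<in> borel_measurable borel" and "\<And>x. 0 \<le> f x"
    and "(\<integral>\<^sup>+x. ennreal (f x) \<partial>lborel) = 1"
    and "integrable lborel (\<lambda>x. \<bar>f x\<bar> powr p)"
    and "integrable lborel (\<lambda>x. \<bar>x\<bar> powr k * f x)"
    and "(\<integral>x. x\<^sup>2 * f x \<partial>lborel) = 1"
    and "fisher_information_std_normal f < \<infinity>"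
  shows "entropically_chaotic (projected_pow (density lborel f)) (density lborel f) \<and>
    (\<forall>\<eta>::real. \<eta> < 1 / 8 * ((k - 2) / (k + 1)) \<longrightarrow>
      (\<exists>C::real. C > 0 \<and>
        (\<forall>N::nat. N \<ge> 1 \<longrightarrow>
          \<bar>ereal (1 / real N)
              * relative_entropy (projected_pow (density lborel f) N) (sphere_uniform N)
            - relative_entropy (density lborel f) (density lborel std_normal_density)\<bar>
          \<le> ereal (C * (real N powr (- \<eta>) + real N powr (- (k / 4 - 1)))))))"
proof -
  note [measurable] = assms(3)
  have sq: "integrable lborel (\<lambda>x. x\<^sup>2 * f x)"
    using assms(8) not_integrable_integral_eq by fastforce
  obtain M where M: "\<And>x. f x \<le> M" "\<And>a b. \<bar>f a - f b\<bar> \<le> M * sqrt \<bar>a - b\<bar>"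
    using fisher_information_imp_bounded_Holder[OF assms(3-5) sq assms(9)] by blast
  have "integrable lborel f" using assms(4,5) by (intro integrableI_nonneg) auto
  have "integrable lborel (\<lambda>x. x ^ 4 * f x)"
  proof (rule Bochner_Integration.integrable_bound)
    show "integrable lborel (\<lambda>x. f x + \<bar>x\<bar> powr k * f x)"
      by (intro Bochner_Integration.integrable_add) fact+
    show "AE x in lborel. norm (x ^ 4 * f x) \<le> norm (f x + \<bar>x\<bar> powr k * f x)"
    proof (rule AE_I2)
      fix x :: real
      \<comment> \<open>The hypothesis k > 4 enters here: the k-th moment dominates the fourth off
        the unit interval, and total mass 1 covers the interval itself.\<close>
      have "x ^ 4 \<le> 1 + \<bar>x\<bar> powr k"
      proof (cases "\<bar>x\<bar> \<le> 1")
        case True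
        then have "\<bar>x\<bar> ^ 4 \<le> 1" by (intro power_le_one) auto
        then show ?thesis by (simp add: add_increasing2)
      next
        case False
        then have "\<bar>x\<bar> powr 4 \<le> \<bar>x\<bar> powr k" using assms(1) by (intro powr_mono) auto
        then show ?thesis using False by (simp add: powr_numeral)
      qed
      then have "x ^ 4 * f x \<le> (1 + \<bar>x\<bar> powr k) * f x" by (rule mult_right_mono) (rule assms(4))
      moreover have "0 \<le> x ^ 4 * f x" using assms(4)[of x] by simp
      ultimately show "norm (x ^ 4 * f x) \<le> norm (f x + \<bar>x\<bar> powr k * f x)"
        unfolding real_norm_def by (simp add: algebra_simps)
    qed
  qed simp
  then interpret bounded_density f M
    using assms M(1) by unfold_locales auto
  obtain C h where C: "C > 0"
    and rel: "\<And>N. N \<ge> 1 \<Longrightarrow> relative_entropy (projected_pow \<mu> N) (sphere_uniform N) = ereal (real N * h N)"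
    and rate: "\<And>N. N \<ge> 1 \<Longrightarrow> \<bar>h N - normal_entropy\<bar> \<le> C * real N powr (- 1 / 8)"
    using projected_entropy_rate[OF M(2)] by blast
  have scaled: "ereal (1 / real N) * relative_entropy (projected_pow \<mu> N) (sphere_uniform N) = ereal (h N)"
    if "N \<ge> 1" for N using that by (simp add: rel)
  have "(\<lambda>N. C * real N powr (- 1 / 8)) \<longlonglongrightarrow> 0" by real_asymp
  then have "(\<lambda>N. h N - normal_entropy) \<longlonglongrightarrow> 0"
    by (rule Lim_null_comparison[rotated])
      (rule eventually_sequentiallyI[of 1], unfold real_norm_def, rule rate)
  then have "(\<lambda>N. ereal (h N)) \<longlonglongrightarrow> ereal normal_entropy" by (simp add: LIM_zero_iff)
  then have lim: "(\<lambda>N. ereal (1 / real N) * relative_entropy (projected_pow \<mu> N) (sphere_uniform N))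
      \<longlonglongrightarrow> relative_entropy \<mu> normal"
    unfolding relative_entropy_mu
    by (rule Lim_transform_eventually) (auto simp: eventually_sequentially scaled intro!: exI[of _ 1])
  have "entropically_chaotic (projected_pow \<mu>) \<mu>"
    unfolding entropically_chaotic_def
    using AE_kac_sphere kac_chaotic_projected_pow lim by (simp add: relative_entropy_mu)
  moreover have "\<exists>C>0. \<forall>N\<ge>1. \<bar>ereal (1 / real N) * relative_entropy (projected_pow \<mu> N) (sphere_uniform N)
        - relative_entropy \<mu> normal\<bar> \<le> ereal (C * (real N powr (- \<eta>) + real N powr (- (k / 4 - 1))))"
    if \<eta>: "\<eta> < 1 / 8 * ((k - 2) / (k + 1))" for \<eta>
  proof (intro exI[of _ C] conjI allI impI C)
    fix N :: nat assume N: "N \<ge> 1"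
    \<comment> \<open>This puts \<eta> below 1/8, negative values included, and powers of a base at
      least 1 are monotone in the exponent; one constant \<open>C\<close> thus serves all
      \<eta>.\<close>
    have "(k - 2) / (k + 1) \<le> 1" using assms(1) by simp
    then have "\<eta> \<le> 1 / 8" using \<eta> by linarith
    then have "real N powr (- 1 / 8) \<le> real N powr (- \<eta>)" using N by (intro powr_mono) auto
    also have "\<dots> \<le> real N powr (- \<eta>) + real N powr (- (k / 4 - 1))" by simp
    finally have "C * real N powr (- 1 / 8) \<le> C * (real N powr (- \<eta>) + real N powr (- (k / 4 - 1)))"
      using C by (intro mult_left_mono) auto
    then show "\<bar>ereal (1 / real N) * relative_entropy (projected_pow \<mu> N) (sphere_uniform N)
        - relative_entropy \<mu> normal\<bar> \<le> ereal (C * (real N powr (- \<eta>) + real N powr (- (k / 4 - 1))))"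
      using rate[OF N] by (simp add: scaled[OF N] relative_entropy_mu)
  qed
  ultimately show ?thesis by blast
qed

end
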